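(* Let $n\ge1$, $2\le\alpha\le2n$, $\gamma>0$, let $M\ge0$ be a constant, and set $q=(2n+\gamma)/\alpha-1$. Let $f\in\mathcal{C}^3(\mathbb{B}^n)$ satisfy $$|\Delta f(z)|\le a(z)\|D_f(z)\|+b(z)|f(z)|+c(z)\quad(z\in\mathbb{B}^n)$$ for real-valued nonnegative continuous functions $a,b,c$ on $\mathbb{B}^n$ with $\sup_{\mathbb{B}^n}a<\infty$, $\sup_{\mathbb{B}^n}b<\infty$ and $c(z)\le M\,d(z)^{-q}$, and suppose $f\in\mathcal{D}_{\gamma,\alpha}(\mathbb{B}^n)$, $\mathrm{Re}(f\overline{\Delta f})\ge0$ and $$\mathrm{Re}\Big\{\sum_{k=1}^{n}\big[\overline{f_{z_{k}}}(\Delta f)_{z_{k}}+\overline{f_{\overline{z}_{k}}}(\Delta f)_{\overline{z}_{k}}\big]\Big\}\ge0$$ in $\mathbb{B}^n$. Then for every $p\ge2$, $$\int_{\mathbb{B}^{n}}d(z)^{pq}\,\Delta\big(|f(z)|^{p}\big)\,dV_{N}(z)<\infty.$$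
   Context: $\mathbb{B}^n$ is the open unit ball of $\mathbb{C}^n$, $d(z)=1-|z|$, $dV_N$ the normalized volume measure, $\Delta=4\sum_k\partial^2/\partial z_k\partial\overline{z}_k$. $D_f=(f_{z_1},\dots,f_{z_n},f_{\overline z_1},\dots,f_{\overline z_n})$ and $\|D_f\|=\big(\sum_k(|f_{z_k}|^2+|f_{\overline z_k}|^2)\big)^{1/2}$. For $\nu\ge0$ and $0<t<\infty$, the Dirichlet-type space $\mathcal{D}_{\nu,t}(\mathbb{B}^n)$ consists of all $f\in\mathcal{C}^1(\mathbb{B}^n)$ with $\int_{\mathbb{B}^n}d(z)^{\nu}\|D_f(z)\|^{t}\,dV_N(z)<\infty$ (norm $|f(0)|+(\int d^\nu\|D_f\|^t dV_N)^{1/t}$). *)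

theory Defs
  imports "HOL-Analysis.Analysis"
begin

definition dirD :: "('a::real_normed_vector \<Rightarrow> 'b::real_normed_vector) \<Rightarrow> 'a \<Rightarrow> 'a \<Rightarrow> 'b" where
  "dirD f v z = frechet_derivative f (at z) v"

fun Ck :: "nat \<Rightarrow> ('a::real_normed_vector \<Rightarrow> 'b::real_normed_vector) \<Rightarrow> 'a set \<Rightarrow> bool" where
  "Ck 0 f S = continuous_on S f"
| "Ck (Suc k) f S = (f differentiable_on S \<and> (\<forall>v. Ck k (\<lambda>z. dirD f v z) S))"

definition unit_ball :: "(complex^'n) set" where
  "unit_ball = ball 0 1"

definition dist_bd :: "complex^'n \<Rightarrow> real" where
  "dist_bd z = 1 - norm z"

definition dx :: "'n \<Rightarrow> (complex^'n \<Rightarrow> complex) \<Rightarrow> complex^'n \<Rightarrow> complex" where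
  "dx k f z = dirD f (axis k 1) z"
definition dy :: "'n \<Rightarrow> (complex^'n \<Rightarrow> complex) \<Rightarrow> complex^'n \<Rightarrow> complex" where
  "dy k f z = dirD f (axis k \<i>) z"
definition dz :: "'n \<Rightarrow> (complex^'n \<Rightarrow> complex) \<Rightarrow> complex^'n \<Rightarrow> complex" where
  "dz k f z = (dx k f z - \<i> * dy k f z) / 2"
definition dzbar :: "'n \<Rightarrow> (complex^'n \<Rightarrow> complex) \<Rightarrow> complex^'n \<Rightarrow> complex" where
  "dzbar k f z = (dx k f z + \<i> * dy k f z) / 2"

definition laplacian :: "(complex^'n \<Rightarrow> complex) \<Rightarrow> complex^'n \<Rightarrow> complex" where
  "laplacian f z = 4 * (\<Sum>k\<in>UNIV. dz k (dzbar k f) z)"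

definition normD :: "(complex^'n \<Rightarrow> complex) \<Rightarrow> complex^'n \<Rightarrow> real" where
  "normD f z = sqrt (\<Sum>k\<in>UNIV. (cmod (dz k f z))\<^sup>2 + (cmod (dzbar k f z))\<^sup>2)"

definition dV_N :: "(complex^'n) measure" where
  "dV_N = scale_measure (inverse (emeasure lebesgue (unit_ball :: (complex^'n) set)))
            (lebesgue_on unit_ball)"

definition dirichlet_space :: "real \<Rightarrow> real \<Rightarrow> (complex^'n \<Rightarrow> complex) set" where
  "dirichlet_space \<nu> t = {f. Ck 1 f unit_ball \<and>
      integrable dV_N (\<lambda>z. dist_bd z powr \<nu> * normD f z powr t)}"

end

theory Submission
  imports Defs
begin

text \<open>
  The second sign condition makes \<open>\<parallel>D\<^sub>f\<parallel>\<^sup>2\<close> subharmonic, because its Laplacian is that real part plus a sum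
  of squares. The sub-mean value inequality at scale \<open>d(z)\<close>, combined with Young's inequality
  \<open>t\<^sup>2 \<le> \<lambda>\<^sup>2 + \<lambda>\<^bsup>2-\<alpha>\<^esup> t\<^bsup>\<alpha>\<^esup>\<close> for \<open>\<lambda> = d(z)\<^bsup>-(q+1)\<^esup>\<close>, turns \<open>f \<in> D\<^sub>\<gamma>\<^sub>,\<^sub>\<alpha>\<close> into \<open>\<parallel>D\<^sub>f\<parallel> \<le> C d\<^bsup>-(q+1)\<^esup>\<close>;
  integrating along radii gives \<open>|f| \<le> B d\<^bsup>-q\<^esup>\<close>. Since \<open>|\<Delta>|f|\<^bsup>p\<^esup>|\<close> is bounded by a multiple of
  \<open>|f|\<^bsup>p-1\<^esup>|\<Delta>f| + |f|\<^bsup>p-2\<^esup>\<parallel>D\<^sub>f\<parallel>\<^sup>2\<close>, the integrand is bounded by a multiple of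
  \<open>d\<^bsup>q\<^esup>|\<Delta>f| + d\<^bsup>2q\<^esup>\<parallel>D\<^sub>f\<parallel>\<^sup>2\<close>. Finally \<open>\<alpha> \<le> 2n\<close> gives \<open>q \<ge> \<gamma>/\<alpha>\<close>, so this is at most a constant times
  \<open>1 + d\<^bsup>\<gamma>\<^esup>\<parallel>D\<^sub>f\<parallel>\<^bsup>\<alpha>\<^esup>\<close>, which is integrable.
\<close>

subsection \<open>Functions of class \<open>C\<^sup>k\<close> and symmetry of second derivatives\<close>

lemma dirD_eqI: "(f has_derivative f') (at z) \<Longrightarrow> dirD f v z = f' v"
  unfolding dirD_def by (simp add: frechet_derivative_at[symmetric])

lemma has_derivative_dirD:
  assumes "f differentiable at z"
  shows "(f has_derivative (\<lambda>v. dirD f v z)) (at z)"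
  using assms unfolding dirD_def by (simp add: frechet_derivative_works)

lemma dirD_cong:
  assumes "open S" "z \<in> S" "\<And>x. x \<in> S \<Longrightarrow> f x = g x"
  shows "dirD f v z = dirD g v z"
proof -
  have "(f has_derivative F) (at z) = (g has_derivative F) (at z)" for F
    using has_derivative_transform_within_open[OF _ assms(1,2)] assms(3) by metis
  then show ?thesis
    unfolding dirD_def frechet_derivative_def by simp
qed

lemma Ck_cong:
  assumes S: "open S" and "\<And>x. x \<in> S \<Longrightarrow> f x = g x" "Ck k f S"
  shows "Ck k g S"
  using assms(2,3)
proof (induction k arbitrary: f g)
  case 0
  then show ?case by (simp cong: continuous_on_cong)
next
  case (Suc k)
  have "f differentiable_on S" using Suc.prems by simp
  then have "g differentiable_on S"
    using Suc.prems(1) unfolding differentiable_on_def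
    by (metis differentiable_transform_within zero_less_one)
  moreover have "Ck k (\<lambda>z. dirD g v z) S" for v
  proof (rule Suc.IH)
    show "Ck k (dirD f v) S" using Suc.prems(2) by simp
    show "dirD f v x = dirD g v x" if "x \<in> S" for x
      by (rule dirD_cong[OF S that Suc.prems(1)])
  qed
  ultimately show ?case by simp
qed

lemma Ck_Suc_imp: "Ck (Suc k) f S \<Longrightarrow> Ck k f S"
proof (induction k arbitrary: f)
  case 0
  then show ?case by (simp add: differentiable_imp_continuous_on)
next
  case (Suc k)
  then show ?case by (metis Ck.simps(2))
qed

lemma Ck_mono: "k \<le> m \<Longrightarrow> Ck m f S \<Longrightarrow> Ck k f S"
  by (induction rule: inc_induct) (use Ck_Suc_imp in blast)+

lemma Ck_continuous: "Ck k f S \<Longrightarrow> continuous_on S f"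
  using Ck_mono[of 0 k f S] by simp

lemma Ck_dirD: "Ck (Suc k) f S \<Longrightarrow> Ck k (dirD f v) S"
  by simp

lemma Ck_differentiable:
  assumes "open S" "Ck k f S" "0 < k" "z \<in> S"
  shows "f differentiable at z"
proof -
  have "Ck (Suc 0) f S" using assms(2,3) Ck_mono[OF Suc_leI] by blast
  then show ?thesis
    using assms(1,4) differentiable_on_eq_differentiable_at by (metis Ck.simps(2))
qed

lemma Ck_has_derivative:
  assumes "open S" "Ck k f S" "0 < k" "z \<in> S"
  shows "(f has_derivative (\<lambda>v. dirD f v z)) (at z)"
  using Ck_differentiable[OF assms] by (rule has_derivative_dirD)

text \<open>Regularity can be proved from any explicit derivative formula valid on \<open>S\<close>.
  Openness matters because \<open>dirD\<close> takes the derivative at a point of the full space, so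
  values on \<open>S\<close> determine it only near interior points.\<close>

lemma Ck_SucI:
  assumes S: "open S"
    and "\<And>x. x \<in> S \<Longrightarrow> (f has_derivative (\<lambda>v. f' v x)) (at x)"
    and "\<And>v. Ck k (f' v) S"
  shows "Ck (Suc k) f S"
proof -
  have "f differentiable_on S"
    using assms(2) unfolding differentiable_on_def
    by (meson differentiableI differentiable_at_withinI)
  moreover have "Ck k (\<lambda>z. dirD f v z) S" for v
    by (rule Ck_cong[OF S _ assms(3)[of v]]) (rule dirD_eqI[OF assms(2), symmetric])
  ultimately show ?thesis by simp
qed

lemma Ck_zero: "Ck k (\<lambda>x. 0) S"
  by (induction k) (simp_all add: dirD_def[abs_def])

lemma dirD_add:
  assumes "f differentiable at z" "g differentiable at z"
  shows "dirD (\<lambda>x. f x + g x) v z = dirD f v z + dirD g v z"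
  using dirD_eqI[OF has_derivative_add[OF assms[THEN has_derivative_dirD]]] .

lemma Ck_add:
  assumes S: "open S" and "Ck k f S" "Ck k g S"
  shows "Ck k (\<lambda>x. f x + g x) S"
  using assms(2,3)
proof (induction k arbitrary: f g)
  case 0
  then show ?case by (simp add: continuous_on_add)
next
  case (Suc k)
  then show ?case
    by (intro Ck_SucI[OF S, where f'="\<lambda>v x. dirD f v x + dirD g v x"])
      (auto intro!: has_derivative_add Ck_has_derivative[OF S, of "Suc k"])
qed

lemma dirD_sum:
  assumes "\<And>i. i \<in> I \<Longrightarrow> f i differentiable at z"
  shows "dirD (\<lambda>x. \<Sum>i\<in>I. f i x) v z = (\<Sum>i\<in>I. dirD (f i) v z)"
  by (rule dirD_eqI[OF has_derivative_sum[OF assms[THEN has_derivative_dirD]]])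

lemma Ck_sum:
  assumes S: "open S" and "\<And>i. i \<in> I \<Longrightarrow> Ck k (f i) S"
  shows "Ck k (\<lambda>x. \<Sum>i\<in>I. f i x) S"
  using assms(2)
  by (induction I rule: infinite_finite_induct) (auto simp: Ck_zero intro!: Ck_add[OF S])

lemma dirD_bounded_linear:
  assumes "bounded_linear L" "f differentiable at z"
  shows "dirD (\<lambda>x. L (f x)) v z = L (dirD f v z)"
  by (rule dirD_eqI[OF bounded_linear.has_derivative[OF assms(1) assms(2)[THEN has_derivative_dirD]]])

lemma Ck_bounded_linear:
  assumes S: "open S" and L: "bounded_linear L" and "Ck k f S"
  shows "Ck k (\<lambda>x. L (f x)) S"
  using assms(3)
proof (induction k arbitrary: f)
  case 0
  then show ?case by (simp add: bounded_linear.continuous_on[OF L])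
next
  case (Suc k)
  then show ?case
    by (intro Ck_SucI[OF S, where f'="\<lambda>v x. L (dirD f v x)"])
      (auto intro!: bounded_linear.has_derivative[OF L] Ck_has_derivative[OF S, of "Suc k"])
qed

lemma dirD_bounded_bilinear:
  assumes "bounded_bilinear B" "f differentiable at z" "g differentiable at z"
  shows "dirD (\<lambda>x. B (f x) (g x)) v z = B (f z) (dirD g v z) + B (dirD f v z) (g z)"
  by (rule dirD_eqI[OF bounded_bilinear.FDERIV[OF assms(1) assms(2,3)[THEN has_derivative_dirD]]])

lemma Ck_bounded_bilinear:
  assumes S: "open S" and B: "bounded_bilinear B" and "Ck k f S" "Ck k g S"
  shows "Ck k (\<lambda>x. B (f x) (g x)) S"
  using assms(3,4)
proof (induction k arbitrary: f g)
  case 0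
  then show ?case by (simp add: bounded_bilinear.continuous_on[OF B])
next
  case (Suc k)
  show ?case
  proof (rule Ck_SucI[OF S, where f'="\<lambda>v x. B (f x) (dirD g v x) + B (dirD f v x) (g x)"])
    show "((\<lambda>x. B (f x) (g x)) has_derivative (\<lambda>v. B (f x) (dirD g v x) + B (dirD f v x) (g x))) (at x)"
      if "x \<in> S" for x
      using Suc.prems that
      by (auto intro!: bounded_bilinear.FDERIV[OF B] Ck_has_derivative[OF S, of "Suc k"])
    show "Ck k (\<lambda>x. B (f x) (dirD g v x) + B (dirD f v x) (g x)) S" for v
      using Suc.prems by (intro Ck_add[OF S] Suc.IH) (auto intro: Ck_Suc_imp Ck_dirD simp del: Ck.simps)
  qed
qed

section \<open>Symmetry of mixed directional derivatives\<close>

lemma has_real_derivative_along_line: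
  fixes g :: "'a::real_normed_vector \<Rightarrow> real"
  assumes "(g has_derivative (\<lambda>v. dirD g v (x + t *\<^sub>R v'))) (at (x + t *\<^sub>R v'))"
  shows "((\<lambda>t. g (x + t *\<^sub>R v')) has_real_derivative dirD g v' (x + t *\<^sub>R v')) (at t)"
proof -
  have 1: "((\<lambda>t. x + t *\<^sub>R v') has_derivative (\<lambda>h. h *\<^sub>R v')) (at t)"
    by (auto intro!: derivative_eq_intros)
  have "((\<lambda>t. g (x + t *\<^sub>R v')) has_derivative (\<lambda>h. dirD g (h *\<^sub>R v') (x + t *\<^sub>R v'))) (at t)"
    using has_derivative_compose[OF 1] assms by blast
  moreover have "dirD g (h *\<^sub>R v') (x + t *\<^sub>R v') = dirD g v' (x + t *\<^sub>R v') * h" for h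
    using linear_cmul[OF has_derivative_linear[OF assms], of h v'] by simp
  ultimately show ?thesis
    by (simp add: has_field_derivative_def mult_commute_abs)
qed

text \<open>The second difference of \<open>g\<close> over a small parallelogram spanned by
  \<open>v\<close> and \<open>w\<close> is symmetric in the two directions. Two mean value steps
  express it through either mixed derivative at nearby points, and continuity of both identifies
  them at \<open>z\<close>.\<close>

lemma dirD_commute_real:
  fixes g :: "'a::real_normed_vector \<Rightarrow> real"
  assumes S: "open S" and g: "Ck 2 g S" and z: "z \<in> S"
  shows "dirD (dirD g v) w z = dirD (dirD g w) v z"
proof -
  have g2: "Ck (Suc (Suc 0)) g S" using g by (simp only: numeral_2_eq_2)
  have mvt: "\<exists>y. norm (y - z) \<le> s * (norm v + norm w) \<and>
      g (z + s *\<^sub>R v + s *\<^sub>R w) - g (z + s *\<^sub>R v) - g (z + s *\<^sub>R w) + g z = s\<^sup>2 * dirD (dirD g v) w y"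
    if s: "0 < s" and sub: "cball z (s * (norm v + norm w)) \<subseteq> S" for s v w
  proof -
    have inS: "z + a *\<^sub>R v + b *\<^sub>R w \<in> S" "norm (a *\<^sub>R v + b *\<^sub>R w) \<le> s * (norm v + norm w)"
      if "0 \<le> a" "a \<le> s" "0 \<le> b" "b \<le> s" for a b
    proof -
      have "norm (a *\<^sub>R v + b *\<^sub>R w) \<le> a * norm v + b * norm w"
        using that norm_triangle_ineq[of "a *\<^sub>R v" "b *\<^sub>R w"] by simp
      also have "\<dots> \<le> s * (norm v + norm w)"
        using that by (simp add: distrib_left add_mono mult_right_mono)
      finally show 1: "norm (a *\<^sub>R v + b *\<^sub>R w) \<le> s * (norm v + norm w)" .
      have "dist z (z + a *\<^sub>R v + b *\<^sub>R w) = norm (a *\<^sub>R v + b *\<^sub>R w)"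
        by (metis add.assoc add_diff_cancel_left' dist_norm norm_minus_commute)
      then show "z + a *\<^sub>R v + b *\<^sub>R w \<in> S" using 1 sub by (auto simp: subset_eq)
    qed
    \<comment> \<open>The second difference is an increment of \<open>F\<close>. One mean value step
      in direction \<open>v\<close> and one in direction \<open>w\<close> produce the mixed
      derivative.\<close>
    define F where "F a = g (z + s *\<^sub>R w + a *\<^sub>R v) - g (z + a *\<^sub>R v)" for a
    have "\<exists>\<xi>. 0 < \<xi> \<and> \<xi> < s \<and> F s - F 0 =
        (s - 0) * (dirD g v (z + s *\<^sub>R w + \<xi> *\<^sub>R v) - dirD g v (z + \<xi> *\<^sub>R v))"
    proof (rule MVT2[OF s])
      fix a :: real assume a: "0 \<le> a" "a \<le> s"
      show "(F has_real_derivative dirD g v (z + s *\<^sub>R w + a *\<^sub>R v) - dirD g v (z + a *\<^sub>R v)) (at a)"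
        unfolding F_def using inS(1)[of a s] inS(1)[of a 0] a s
        by (intro DERIV_diff has_real_derivative_along_line Ck_has_derivative[OF S g2]) (auto simp: algebra_simps)
    qed
    then obtain \<xi> where \<xi>: "0 < \<xi>" "\<xi> < s" "F s - F 0 =
        s * (dirD g v (z + s *\<^sub>R w + \<xi> *\<^sub>R v) - dirD g v (z + \<xi> *\<^sub>R v))" by auto
    have "\<exists>\<eta>. 0 < \<eta> \<and> \<eta> < s \<and> dirD g v (z + \<xi> *\<^sub>R v + s *\<^sub>R w) - dirD g v (z + \<xi> *\<^sub>R v + 0 *\<^sub>R w) =
        (s - 0) * dirD (dirD g v) w (z + \<xi> *\<^sub>R v + \<eta> *\<^sub>R w)"
    proof (rule MVT2[OF s])
      fix a :: real assume a: "0 \<le> a" "a \<le> s"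
      show "((\<lambda>a. dirD g v (z + \<xi> *\<^sub>R v + a *\<^sub>R w)) has_real_derivative
             dirD (dirD g v) w (z + \<xi> *\<^sub>R v + a *\<^sub>R w)) (at a)"
        using inS(1)[of \<xi> a] a \<xi>
        by (intro has_real_derivative_along_line Ck_has_derivative[OF S Ck_dirD[OF g2]]) auto
    qed
    then obtain \<eta> where \<eta>: "0 < \<eta>" "\<eta> < s" "dirD g v (z + \<xi> *\<^sub>R v + s *\<^sub>R w) - dirD g v (z + \<xi> *\<^sub>R v) =
        s * dirD (dirD g v) w (z + \<xi> *\<^sub>R v + \<eta> *\<^sub>R w)" by auto
    have "g (z + s *\<^sub>R v + s *\<^sub>R w) - g (z + s *\<^sub>R v) - g (z + s *\<^sub>R w) + g z = F s - F 0"
      by (simp add: F_def algebra_simps)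
    also have "\<dots> = s\<^sup>2 * dirD (dirD g v) w (z + \<xi> *\<^sub>R v + \<eta> *\<^sub>R w)"
      using \<xi>(3) \<eta>(3) by (simp add: algebra_simps power2_eq_square)
    finally show ?thesis
      using inS(2)[of \<xi> \<eta>] \<xi> \<eta> by (intro exI[of _ "z + \<xi> *\<^sub>R v + \<eta> *\<^sub>R w"]) (auto simp: algebra_simps)
  qed
  have cont: "isCont (dirD (dirD g v) w) z" for v w
    using g2 S z by (simp add: continuous_on_eq_continuous_at)
  define K where "K = norm v + norm w"
  obtain \<epsilon> where \<epsilon>: "\<epsilon> > 0" "cball z \<epsilon> \<subseteq> S" using S z open_contains_cball by blast
  have K: "K \<ge> 0" by (simp add: K_def)
  have "\<exists>y y'. norm (y - z) \<le> s * K \<and> norm (y' - z) \<le> s * K \<and>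
          dirD (dirD g v) w y = dirD (dirD g w) v y'"
    if s: "0 < s" "s * K \<le> \<epsilon>" for s
  proof -
    have sub: "cball z (s * K) \<subseteq> S" using s \<epsilon>(2) by (meson cball_subset_cball_iff order_trans subset_cball)
    obtain y where y: "norm (y - z) \<le> s * K"
      "g (z + s *\<^sub>R v + s *\<^sub>R w) - g (z + s *\<^sub>R v) - g (z + s *\<^sub>R w) + g z = s\<^sup>2 * dirD (dirD g v) w y"
      using mvt[OF s(1), of v w] sub unfolding K_def by blast
    \<comment> \<open>The same second difference, with the roles of \<open>v\<close> and
      \<open>w\<close> exchanged.\<close>
    obtain y' where y': "norm (y' - z) \<le> s * K"
      "g (z + s *\<^sub>R w + s *\<^sub>R v) - g (z + s *\<^sub>R w) - g (z + s *\<^sub>R v) + g z = s\<^sup>2 * dirD (dirD g w) v y'"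
      using mvt[OF s(1), of w v] sub unfolding K_def by (auto simp: add.commute)
    have "s\<^sup>2 * dirD (dirD g v) w y = s\<^sup>2 * dirD (dirD g w) v y'"
      unfolding y(2)[symmetric] y'(2)[symmetric] by (simp add: algebra_simps)
    then show ?thesis using y(1) y'(1) s by auto
  qed
  note ex = this
  show ?thesis
  proof (rule ccontr)
    assume ne: "dirD (dirD g v) w z \<noteq> dirD (dirD g w) v z"
    define e where "e = \<bar>dirD (dirD g v) w z - dirD (dirD g w) v z\<bar> / 2"
    have e: "e > 0" using ne by (simp add: e_def)
    obtain d1 where d1: "d1 > 0" "\<And>y. norm (y - z) < d1 \<Longrightarrow> \<bar>dirD (dirD g v) w y - dirD (dirD g v) w z\<bar> < e"
      using cont[of v w] e unfolding continuous_at_eps_delta dist_norm by (metis real_norm_def)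
    obtain d2 where d2: "d2 > 0" "\<And>y. norm (y - z) < d2 \<Longrightarrow> \<bar>dirD (dirD g w) v y - dirD (dirD g w) v z\<bar> < e"
      using cont[of w v] e unfolding continuous_at_eps_delta dist_norm by (metis real_norm_def)
    define m where "m = min \<epsilon> (min d1 d2)"
    have m: "m > 0" "m \<le> \<epsilon>" "m \<le> d1" "m \<le> d2" using \<epsilon> d1 d2 by (auto simp: m_def)
    \<comment> \<open>The summand 1 keeps the denominator positive when \<open>v\<close> and
      \<open>w\<close> are both 0, and it makes \<open>s * K < m\<close> strict.\<close>
    define s where "s = m / (K + 1)"
    have s: "s > 0" "s * K < m" using m K by (auto simp: s_def divide_simps)
    obtain y y' where "norm (y - z) \<le> s * K" "norm (y' - z) \<le> s * K"
      "dirD (dirD g v) w y = dirD (dirD g w) v y'"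
      using ex[of s] s m by auto
    moreover from this have "norm (y - z) < d1" "norm (y' - z) < d2" using s m by linarith+
    ultimately have "\<bar>dirD (dirD g v) w y - dirD (dirD g v) w z\<bar> < e" "\<bar>dirD (dirD g v) w y - dirD (dirD g w) v z\<bar> < e"
      using d1(2)[of y] d2(2)[of y'] by auto
    moreover have "\<bar>a - b\<bar> \<le> \<bar>x - a\<bar> + \<bar>x - b\<bar>" for a b x :: real
      by linarith
    ultimately show False unfolding e_def by (smt (verit) field_sum_of_halves)
  qed
qed

text \<open>Pairing with a fixed vector \<open>c\<close> commutes with \<open>dirD\<close>, so the
  scalar case applies to every component, and the pairings with all \<open>c\<close> determine a
  vector.\<close>

lemma dirD_commute:
  fixes g :: "'a::real_normed_vector \<Rightarrow> 'b::real_inner"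
  assumes S: "open S" and g: "Ck 2 g S" and z: "z \<in> S"
  shows "dirD (dirD g v) w z = dirD (dirD g w) v z"
proof -
  have g2: "Ck (Suc (Suc 0)) g S" using g by (simp only: numeral_2_eq_2)
  have *: "dirD (dirD (\<lambda>x. g x \<bullet> c) v) w z = dirD (dirD g v) w z \<bullet> c" for v w :: 'a and c :: 'b
  proof -
    have "dirD (dirD (\<lambda>x. g x \<bullet> c) v) w z = dirD (\<lambda>x. dirD g v x \<bullet> c) w z"
      by (rule dirD_cong[OF S z], rule dirD_bounded_linear[OF bounded_linear_inner_left])
        (rule Ck_differentiable[OF S g2], auto)
    also have "\<dots> = dirD (dirD g v) w z \<bullet> c"
      by (rule dirD_bounded_linear[OF bounded_linear_inner_left])
        (rule Ck_differentiable[OF S Ck_dirD[OF g2]], auto simp: z)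
    finally show ?thesis .
  qed
  have "Ck 2 (\<lambda>x. g x \<bullet> c) S" for c
    by (rule Ck_bounded_linear[OF S bounded_linear_inner_left g])
  from dirD_commute_real[OF S this z, where v=v and w=w]
  have "\<forall>c. dirD (dirD g v) w z \<bullet> c = dirD (dirD g w) v z \<bullet> c"
    unfolding * by blast
  then show ?thesis by (simp only: vector_eq_rdot)
qed

subsection \<open>The Laplacian\<close>

text \<open>The Laplacian as the trace of the second derivative over the real orthonormal basis.
  Unlike \<open>laplacian\<close> it applies to real-valued functions such as the square of
  \<open>normD f\<close>, and it fits integration by parts in real coordinates.\<close>

definition basis_laplacian :: "('a::euclidean_space \<Rightarrow> 'b::real_normed_vector) \<Rightarrow> 'a \<Rightarrow> 'b" where
  "basis_laplacian f z = (\<Sum>v\<in>Basis. dirD (dirD f v) v z)"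

lemma Ck_basis_laplacian:
  assumes "open S" "Ck (Suc (Suc k)) f S"
  shows "Ck k (basis_laplacian f) S"
  unfolding basis_laplacian_def[abs_def] using assms by (intro Ck_sum) auto

lemma basis_laplacian_bounded_linear:
  assumes S: "open S" and L: "bounded_linear L" and f: "Ck 2 f S" and z: "z \<in> S"
  shows "basis_laplacian (\<lambda>x. L (f x)) z = L (basis_laplacian f z)"
proof -
  have f2: "Ck (Suc (Suc 0)) f S" using f by (simp only: numeral_2_eq_2)
  have "dirD (dirD (\<lambda>x. L (f x)) v) v z = L (dirD (dirD f v) v z)" for v
  proof -
    have "dirD (dirD (\<lambda>x. L (f x)) v) v z = dirD (\<lambda>x. L (dirD f v x)) v z"
      by (intro dirD_cong[OF S z] dirD_bounded_linear[OF L] Ck_differentiable[OF S f2]) auto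
    also have "\<dots> = L (dirD (dirD f v) v z)"
      by (intro dirD_bounded_linear[OF L] Ck_differentiable[OF S Ck_dirD[OF f2]] z) auto
    finally show ?thesis .
  qed
  then show ?thesis
    by (simp add: basis_laplacian_def linear_sum[OF bounded_linear.linear[OF L]])
qed

lemma basis_laplacian_add:
  assumes S: "open S" and f: "Ck 2 f S" and g: "Ck 2 g S" and z: "z \<in> S"
  shows "basis_laplacian (\<lambda>x. f x + g x) z = basis_laplacian f z + basis_laplacian g z"
proof -
  have f2: "Ck (Suc (Suc 0)) f S" "Ck (Suc (Suc 0)) g S" using f g by (simp_all only: numeral_2_eq_2)
  have "dirD (dirD (\<lambda>x. f x + g x) v) v z = dirD (dirD f v) v z + dirD (dirD g v) v z" for v
  proof -
    have "dirD (dirD (\<lambda>x. f x + g x) v) v z = dirD (\<lambda>x. dirD f v x + dirD g v x) v z"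
      by (intro dirD_cong[OF S z] dirD_add Ck_differentiable[OF S f2(1)] Ck_differentiable[OF S f2(2)]) auto
    also have "\<dots> = dirD (dirD f v) v z + dirD (dirD g v) v z"
      by (intro dirD_add Ck_differentiable[OF S Ck_dirD[OF f2(1)]] Ck_differentiable[OF S Ck_dirD[OF f2(2)]] z) auto
    finally show ?thesis .
  qed
  then show ?thesis by (simp add: basis_laplacian_def sum.distrib)
qed

lemma basis_laplacian_zero: "basis_laplacian (\<lambda>x. 0) z = 0"
  by (simp add: basis_laplacian_def dirD_def[abs_def])

lemma basis_laplacian_sum:
  assumes S: "open S" and f: "\<And>i. i \<in> I \<Longrightarrow> Ck 2 (f i) S" and z: "z \<in> S"
  shows "basis_laplacian (\<lambda>x. \<Sum>i\<in>I. f i x) z = (\<Sum>i\<in>I. basis_laplacian (f i) z)"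
  using f
proof (induction I rule: infinite_finite_induct)
  case (insert i I)
  have "basis_laplacian (\<lambda>x. f i x + (\<Sum>i\<in>I. f i x)) z = basis_laplacian (f i) z + basis_laplacian (\<lambda>x. \<Sum>i\<in>I. f i x) z"
    using insert.prems by (intro basis_laplacian_add[OF S _ _ z] Ck_sum[OF S]) blast+
  then show ?case using insert by simp
qed (simp_all add: basis_laplacian_zero)

text \<open>The direction \<open>w\<close> is moved outward in two swaps: one for \<open>f\<close>
  at all points of \<open>S\<close>, one for \<open>dirD f v\<close>, which is still of class
  \<open>C\<^sup>2\<close>. This is where three derivatives of \<open>f\<close> are spent.\<close>

lemma basis_laplacian_dirD:
  fixes f :: "'a::euclidean_space \<Rightarrow> 'b::real_inner"
  assumes S: "open S" and f: "Ck 3 f S" and z: "z \<in> S"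
  shows "basis_laplacian (dirD f w) z = dirD (basis_laplacian f) w z"
proof -
  have f3: "Ck (Suc (Suc (Suc 0))) f S" using f by (simp only: numeral_3_eq_3)
  have f2: "Ck 2 f S" using Ck_mono[OF _ f, of 2] by simp
  have df2: "Ck 2 (dirD f v) S" for v using Ck_dirD[OF f3] by (simp only: numeral_2_eq_2)
  have "basis_laplacian (dirD f w) z = (\<Sum>v\<in>Basis. dirD (dirD (dirD f v) v) w z)"
    unfolding basis_laplacian_def
  proof (rule sum.cong[OF refl])
    fix v :: 'a
    have "dirD (dirD (dirD f w) v) v z = dirD (dirD (dirD f v) w) v z"
      by (rule dirD_cong[OF S z dirD_commute[OF S f2]])
    also have "\<dots> = dirD (dirD (dirD f v) v) w z"
      by (rule dirD_commute[OF S df2 z])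
    finally show "dirD (dirD (dirD f w) v) v z = dirD (dirD (dirD f v) v) w z" .
  qed
  also have "\<dots> = dirD (basis_laplacian f) w z"
    unfolding basis_laplacian_def[abs_def]
    by (rule dirD_sum[symmetric], rule Ck_differentiable[OF S Ck_dirD[OF Ck_dirD[OF f3]]]) (use z in auto)
  finally show ?thesis .
qed

text \<open>The product rule applied twice in each basis direction. The first sum is nonnegative,
  which later yields subharmonicity.\<close>

lemma basis_laplacian_inner_self:
  fixes g :: "'a::euclidean_space \<Rightarrow> 'b::real_inner"
  assumes S: "open S" and g: "Ck 2 g S" and z: "z \<in> S"
  shows "basis_laplacian (\<lambda>x. g x \<bullet> g x) z =
    2 * (\<Sum>v\<in>Basis. (norm (dirD g v z))\<^sup>2) + 2 * (g z \<bullet> basis_laplacian g z)"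
proof -
  have g2: "Ck (Suc (Suc 0)) g S" using g by (simp only: numeral_2_eq_2)
  have gd: "g differentiable at x" if "x \<in> S" for x
    by (rule Ck_differentiable[OF S g2 _ that]) auto
  have gd2: "dirD g v differentiable at z" for v
    by (rule Ck_differentiable[OF S Ck_dirD[OF g2] _ z]) auto
  have "dirD (dirD (\<lambda>x. g x \<bullet> g x) v) v z = 2 * (norm (dirD g v z))\<^sup>2 + 2 * (g z \<bullet> dirD (dirD g v) v z)" for v
  proof -
    have "dirD (dirD (\<lambda>x. g x \<bullet> g x) v) v z = dirD (\<lambda>x. 2 *\<^sub>R (g x \<bullet> dirD g v x)) v z"
      using gd by (intro dirD_cong[OF S z])
        (simp add: dirD_bounded_bilinear[OF bounded_bilinear_inner] inner_commute)
    also have "\<dots> = 2 *\<^sub>R dirD (\<lambda>x. g x \<bullet> dirD g v x) v z"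
      using differentiable_inner[OF gd[OF z] gd2] by (intro dirD_bounded_linear bounded_linear_scaleR_right)
    also have "dirD (\<lambda>x. g x \<bullet> dirD g v x) v z = g z \<bullet> dirD (dirD g v) v z + dirD g v z \<bullet> dirD g v z"
      by (rule dirD_bounded_bilinear[OF bounded_bilinear_inner gd[OF z] gd2])
    finally show ?thesis by (simp add: power2_norm_eq_inner algebra_simps)
  qed
  then show ?thesis
    by (simp add: basis_laplacian_def sum.distrib sum_distrib_left inner_sum_right)
qed

section \<open>Complex coordinates and the gradient norm\<close>

lemma sum_Basis_complex_vec:
  "(\<Sum>v\<in>(Basis::(complex^'n) set). F v) = (\<Sum>k\<in>UNIV. F (axis k 1) + F (axis k \<i>))"
proof -
  have "(Basis::(complex^'n) set) = (\<Union>k\<in>UNIV. {axis k 1, axis k \<i>})"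
    by (auto simp: Basis_vec_def Basis_complex_def)
  also have "sum F \<dots> = (\<Sum>k\<in>UNIV. sum F {axis k 1, axis k \<i>})"
    by (rule sum.UNION_disjoint) (auto simp: axis_eq_axis)
  finally show ?thesis by (simp add: axis_eq_axis)
qed

lemma dz_eq: "dz k f = (\<lambda>z. (1/2) * dirD f (axis k 1) z + (- \<i>/2) * dirD f (axis k \<i>) z)"
  by (simp add: fun_eq_iff dz_def dx_def dy_def field_simps)

lemma dzbar_eq: "dzbar k f = (\<lambda>z. (1/2) * dirD f (axis k 1) z + (\<i>/2) * dirD f (axis k \<i>) z)"
  by (simp add: fun_eq_iff dzbar_def dx_def dy_def field_simps)

lemma Ck_combination:
  fixes f g :: "'a::real_normed_vector \<Rightarrow> complex"
  assumes "open S" "Ck k f S" "Ck k g S"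
  shows "Ck k (\<lambda>z. \<alpha> * f z + \<beta> * g z) S"
  using assms by (intro Ck_add Ck_bounded_linear[where L="(*) c" for c] bounded_linear_mult_right)

lemma dirD_combination:
  fixes f g :: "'a::real_normed_vector \<Rightarrow> complex"
  assumes "f differentiable at z" "g differentiable at z"
  shows "dirD (\<lambda>z. \<alpha> * f z + \<beta> * g z) v z = \<alpha> * dirD f v z + \<beta> * dirD g v z"
  by (rule dirD_eqI)
    (intro has_derivative_add bounded_linear.has_derivative[OF bounded_linear_mult_right]
      assms[THEN has_derivative_dirD])

lemma Ck_dz: "open S \<Longrightarrow> Ck (Suc m) f S \<Longrightarrow> Ck m (dz k f) S"
  unfolding dz_eq by (rule Ck_combination) auto

lemma Ck_dzbar: "open S \<Longrightarrow> Ck (Suc m) f S \<Longrightarrow> Ck m (dzbar k f) S"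
  unfolding dzbar_eq by (rule Ck_combination) auto

text \<open>In 4 times the product of the two Wirtinger operators the mixed terms carry opposite
  factors i and cancel by symmetry of second derivatives.\<close>

lemma laplacian_eq_basis_laplacian:
  fixes f :: "complex^'n \<Rightarrow> complex"
  assumes S: "open S" and f: "Ck 2 f S" and z: "z \<in> S"
  shows "laplacian f z = basis_laplacian f z"
proof -
  have f2: "Ck (Suc (Suc 0)) f S" using f by (simp only: numeral_2_eq_2)
  have d: "dirD f v differentiable at z" for v
    by (rule Ck_differentiable[OF S Ck_dirD[OF f2] _ z]) auto
  have "4 * dz k (dzbar k f) z = dirD (dirD f (axis k 1)) (axis k 1) z + dirD (dirD f (axis k \<i>)) (axis k \<i>) z" for k
    unfolding dz_eq dzbar_eq dirD_combination[OF d d]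
    using dirD_commute[OF S f z, of "axis k 1" "axis k \<i>"] by (simp add: algebra_simps)
  then show ?thesis
    by (simp add: laplacian_def basis_laplacian_def sum_Basis_complex_vec sum_distrib_left)
qed

text \<open>Both \<open>dz k\<close> and \<open>dzbar k\<close> are constant combinations of two
  directional derivatives, so this one computation shows that the Laplacian commutes with each of
  them.\<close>

lemma basis_laplacian_combination:
  fixes f :: "complex^'n \<Rightarrow> complex"
  assumes S: "open S" and f: "Ck 3 f S" and z: "z \<in> S"
  shows "basis_laplacian (\<lambda>z. \<alpha> * dirD f v z + \<beta> * dirD f w z) z =
    \<alpha> * dirD (laplacian f) v z + \<beta> * dirD (laplacian f) w z"
proof -
  have f3: "Ck (Suc (Suc (Suc 0))) f S" using f by (simp only: numeral_3_eq_3)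
  have f2: "Ck 2 f S" using Ck_mono[OF _ f, of 2] by simp
  have df2: "Ck 2 (dirD f v) S" for v using Ck_dirD[OF f3] by (simp only: numeral_2_eq_2)
  have L: "dirD (laplacian f) v z = basis_laplacian (dirD f v) z" for v
    unfolding basis_laplacian_dirD[OF S f z]
    by (rule dirD_cong[OF S z laplacian_eq_basis_laplacian[OF S f2]])
  note m = bounded_linear_mult_right
  show ?thesis
    unfolding L by (simp add: basis_laplacian_add[OF S _ _ z] Ck_bounded_linear[OF S m df2]
      basis_laplacian_bounded_linear[OF S m df2 z])
qed

lemma normD_square:
  "(normD f z)\<^sup>2 = (\<Sum>k\<in>UNIV. dz k f z \<bullet> dz k f z + dzbar k f z \<bullet> dzbar k f z)"
  unfolding normD_def by (simp add: sum_nonneg power2_norm_eq_inner)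

lemma normD_nonneg: "0 \<le> normD f z"
  by (simp add: normD_def sum_nonneg)

text \<open>The parallelogram law, applied in each complex coordinate to a and ib, where a and b are
  the two real partial derivatives.\<close>

lemma sum_norm_dirD_square:
  fixes f :: "complex^'n \<Rightarrow> complex"
  shows "(\<Sum>v\<in>Basis. (norm (dirD f v z))\<^sup>2) = 2 * (normD f z)\<^sup>2"
proof -
  have "(norm a)\<^sup>2 + (norm b)\<^sup>2 = 2 * (((a - \<i> * b) / 2) \<bullet> ((a - \<i> * b) / 2) + ((a + \<i> * b) / 2) \<bullet> ((a + \<i> * b) / 2))"
    for a b :: complex
    by (simp only: power2_norm_eq_inner inner_complex_def) (simp add: field_simps)
  then show ?thesis
    unfolding normD_square sum_Basis_complex_vec sum_distrib_left dz_def dzbar_def dx_def dy_def by simp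
qed

lemma Ck_normD_square:
  fixes f :: "complex^'n \<Rightarrow> complex"
  assumes S: "open S" and f: "Ck 3 f S"
  shows "Ck 2 (\<lambda>z. (normD f z)\<^sup>2) S"
proof -
  have f3: "Ck (Suc 2) f S" using f by simp
  show ?thesis unfolding normD_square
    by (intro Ck_sum[OF S] Ck_add[OF S] Ck_bounded_bilinear[OF S bounded_bilinear_inner] Ck_dz[OF S f3] Ck_dzbar[OF S f3])
qed

lemma inner_eq_Re_cnj_mult: "a \<bullet> b = Re (cnj a * b)"
  by (simp add: inner_complex_def)

text \<open>Each component of the gradient contributes squares of its own derivatives plus twice its
  inner product with its Laplacian. Dropping the squares leaves twice the real part assumed
  nonnegative in \<open>re\<close>.\<close>

lemma basis_laplacian_normD_square_nonneg:
  fixes f :: "complex^'n \<Rightarrow> complex"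
  assumes S: "open S" and f: "Ck 3 f S" and z: "z \<in> S"
    and re: "0 \<le> Re (\<Sum>k\<in>UNIV. cnj (dz k f z) * dz k (laplacian f) z
               + cnj (dzbar k f z) * dzbar k (laplacian f) z)"
  shows "0 \<le> basis_laplacian (\<lambda>z. (normD f z)\<^sup>2) z"
proof -
  have f3: "Ck (Suc 2) f S" using f by simp
  note d = Ck_dz[OF S f3] Ck_dzbar[OF S f3]
  note C = Ck_bounded_bilinear[OF S bounded_bilinear_inner]
  have "basis_laplacian (\<lambda>z. (normD f z)\<^sup>2) z =
    (\<Sum>k\<in>UNIV. basis_laplacian (\<lambda>z. dz k f z \<bullet> dz k f z) z + basis_laplacian (\<lambda>z. dzbar k f z \<bullet> dzbar k f z) z)"
    unfolding normD_square
    by (subst basis_laplacian_sum[OF S _ z])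
      (auto intro!: Ck_add[OF S] C d sum.cong basis_laplacian_add[OF S C C z])
  also have "\<dots> \<ge> (\<Sum>k\<in>UNIV. 2 * (dz k f z \<bullet> dz k (laplacian f) z) + 2 * (dzbar k f z \<bullet> dzbar k (laplacian f) z))"
  proof (rule sum_mono, rule add_mono)
    fix k
    have 1: "basis_laplacian (dz k f) z = dz k (laplacian f) z" "basis_laplacian (dzbar k f) z = dzbar k (laplacian f) z"
      unfolding dz_eq dzbar_eq basis_laplacian_combination[OF S f z] by (rule refl)+
    show "2 * (dz k f z \<bullet> dz k (laplacian f) z) \<le> basis_laplacian (\<lambda>z. dz k f z \<bullet> dz k f z) z"
      by (simp add: basis_laplacian_inner_self[OF S d(1) z] 1 sum_nonneg)
    show "2 * (dzbar k f z \<bullet> dzbar k (laplacian f) z) \<le> basis_laplacian (\<lambda>z. dzbar k f z \<bullet> dzbar k f z) z"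
      by (simp add: basis_laplacian_inner_self[OF S d(2) z] 1 sum_nonneg)
  qed
  also have "(\<Sum>k\<in>UNIV. 2 * (dz k f z \<bullet> dz k (laplacian f) z) + 2 * (dzbar k f z \<bullet> dzbar k (laplacian f) z)) =
    2 * Re (\<Sum>k\<in>UNIV. cnj (dz k f z) * dz k (laplacian f) z + cnj (dzbar k f z) * dzbar k (laplacian f) z)"
    by (simp only: inner_eq_Re_cnj_mult Re_sum plus_complex.simps sum_distrib_left distrib_left)
  finally show ?thesis using re by linarith
qed

subsection \<open>Sub-mean value inequality\<close>

text \<open>Translating a function supported in the cube does not change its integral over a larger
  box. Differentiating the translated integral at 0 under the integral sign gives the integral of
  the derivative \<open>g\<close>.\<close>

lemma integral_directional_derivative_eq_0:
  fixes h g :: "'a::euclidean_space \<Rightarrow> real"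
  assumes h: "\<And>x. ((\<lambda>t. h (x + t *\<^sub>R b)) has_real_derivative g x) (at 0)"
    and b: "b \<in> Basis"
    and g: "continuous_on UNIV g" and hc: "continuous_on UNIV h"
    and h0: "\<And>x. x \<notin> cbox (- One) One \<Longrightarrow> h x = 0"
    and g0: "\<And>x. x \<notin> cbox (- One) One \<Longrightarrow> g x = 0"
  shows "integral (cbox (- One) One) g = 0"
proof -
  have sup: "integral (cbox u v) k = integral (cbox (- One) One) k"
    if "cbox (- One) One \<subseteq> cbox u v" "continuous_on UNIV k" "\<And>x. x \<notin> cbox (- One) One \<Longrightarrow> k x = 0"
    for u v :: 'a and k :: "'a \<Rightarrow> real"
    by (rule integral_unique, rule has_integral_on_superset[OF _ that(3,1)], rule integrable_integral,
        rule integrable_continuous, rule continuous_on_subset[OF that(2)]) auto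
  \<comment> \<open>Doubling the box leaves room for every shift with \<bar>t\<bar> \<le> 1, so the
    shifted box still contains the unit cube.\<close>
  define F where "F t = integral (cbox (- 2 *\<^sub>R One) (2 *\<^sub>R One)) (\<lambda>x. h (x + t *\<^sub>R b))" for t
  have F: "F t = integral (cbox (- One) One) h" if "t \<in> {-1..1}" for t
  proof -
    have "F t = integral (cbox (- 2 *\<^sub>R One + t *\<^sub>R b) (2 *\<^sub>R One + t *\<^sub>R b)) h"
      unfolding F_def using integral_shift_cbox_plus[where f=h and c="t *\<^sub>R b" and a="- 2 *\<^sub>R One" and b="2 *\<^sub>R One"]
      by (simp add: o_def add.commute)
    also have "\<dots> = integral (cbox (- One) One) h"
    proof (rule sup[OF _ hc h0])
      have "\<bar>t * (b \<bullet> i)\<bar> \<le> 1" if "i \<in> Basis" for i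
        using that b \<open>t \<in> {-1..1}\<close> by (auto simp: inner_Basis)
      then show "cbox (- One) One \<subseteq> cbox (- 2 *\<^sub>R One + t *\<^sub>R b) (2 *\<^sub>R One + t *\<^sub>R b)"
        by (auto simp: subset_box inner_simps abs_le_iff) (smt (verit))+
    qed auto
    finally show ?thesis .
  qed
  have hx: "((\<lambda>t. h (x + t *\<^sub>R b)) has_real_derivative g (x + t *\<^sub>R b)) (at t)" for x t
  proof -
    have "((\<lambda>s. h ((x + t *\<^sub>R b) + s *\<^sub>R b)) has_real_derivative g (x + t *\<^sub>R b)) (at (t - t))"
      using h by simp
    then show ?thesis
      using DERIV_shift[of "\<lambda>s. h ((x + t *\<^sub>R b) + s *\<^sub>R b)" "g (x + t *\<^sub>R b)" t "-t"]
      by (simp add: algebra_simps)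
  qed
  have "(F has_real_derivative integral (cbox (- 2 *\<^sub>R One) (2 *\<^sub>R One)) (\<lambda>x. g (x + 0 *\<^sub>R b))) (at 0 within {-1<..<1})"
    unfolding F_def
  proof (rule leibniz_rule_field_derivative)
    show "((\<lambda>t. h (x + t *\<^sub>R b)) has_real_derivative g (x + t *\<^sub>R b)) (at t within {-1<..<1})" for x t
      using hx by (rule has_field_derivative_at_within)
    show "(\<lambda>x. h (x + t *\<^sub>R b)) integrable_on cbox (- 2 *\<^sub>R One) (2 *\<^sub>R One)" for t
      by (intro integrable_continuous continuous_on_compose2[OF hc] continuous_intros) auto
    show "continuous_on ({-1<..<1} \<times> cbox (- 2 *\<^sub>R One) (2 *\<^sub>R One)) (\<lambda>(t, x). g (x + t *\<^sub>R b))"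
      unfolding split_beta
      by (intro continuous_on_compose2[OF g] continuous_intros) auto
  qed auto
  moreover have "(F has_real_derivative 0) (at 0 within {-1<..<1})"
    by (rule has_field_derivative_transform_within[OF DERIV_const[of "integral (cbox (- One) One) h"], of 1])
      (auto simp: F)
  ultimately have "integral (cbox (- 2 *\<^sub>R One) (2 *\<^sub>R One)) (\<lambda>x. g (x + 0 *\<^sub>R b)) = 0"
    by (simp add: at_within_open[where S="{-1<..<1}"] DERIV_unique)
  moreover have "integral (cbox (- 2 *\<^sub>R One) (2 *\<^sub>R One)) g = integral (cbox (- One) One) g"
    by (rule sup[OF _ g g0]) (auto simp: subset_box inner_simps)
  ultimately show ?thesis by simp
qed

text \<open>
  The radial weight is chosen because \<open>bump 2 x\<close> times \<open>x\<close> is a multiple of the gradient of \<open>bump 3\<close>, so that the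
  derivative in \<open>r\<close> of the weighted mean of \<open>u (z + r x)\<close> is \<open>r/6\<close> times the mean of \<open>\<Delta>u\<close> against \<open>bump 3\<close>.
  Integrals run over the cube \<open>[-1,1]\<^sup>N\<close> because the Leibniz rule is available for boxes.
\<close>

definition bump :: "nat \<Rightarrow> 'a::euclidean_space \<Rightarrow> real" where
  "bump m x = (max 0 (1 - x \<bullet> x)) ^ m"

lemma bump_nonneg: "0 \<le> bump m x"
  by (simp add: bump_def)

lemma bump_le_1: "bump m x \<le> 1"
  by (simp add: bump_def power_le_one)

lemma continuous_on_bump: "continuous_on S (bump m)"
  unfolding bump_def[abs_def] by (intro continuous_intros)

lemma bump_eq_0: "1 \<le> norm x \<Longrightarrow> 0 < m \<Longrightarrow> bump m x = 0"
  using power_mono[of 1 "norm x" 2] by (simp add: bump_def flip: power2_norm_eq_inner)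

text \<open>The exponent is at least 2, so at the kink the difference quotient is bounded by a
  positive power of \<bar>h\<bar> and tends to 0.\<close>

lemma DERIV_max_0_power:
  fixes s :: real
  shows "((\<lambda>s. (max 0 s) ^ Suc (Suc m)) has_real_derivative (real m + 2) * (max 0 s) ^ Suc m) (at s)"
proof (cases "s = 0")
  case True
  have "(\<lambda>h::real. max 0 h ^ Suc (Suc m) / h) \<midarrow>0\<rightarrow> 0"
  proof (rule Lim_null_comparison)
    show "\<forall>\<^sub>F h in at 0. norm (max 0 h ^ Suc (Suc m) / h) \<le> \<bar>h\<bar> ^ Suc m"
      by (rule always_eventually) (auto simp: max_def mult_nonpos_nonneg)
    show "(\<lambda>h::real. \<bar>h\<bar> ^ Suc m) \<midarrow>0\<rightarrow> 0"
      by (auto intro!: tendsto_eq_intros)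
  qed
  then show ?thesis using True by (simp add: DERIV_def)
next
  case False
  show ?thesis
  proof (cases "s > 0")
    case True
    have "((\<lambda>s. s ^ Suc (Suc m)) has_real_derivative (real m + 2) * max 0 s ^ Suc m) (at s)"
      using DERIV_pow[of "Suc (Suc m)" s] True by (simp add: algebra_simps)
    then show ?thesis
      by (rule has_field_derivative_transform_within_open[where S="{0<..}"]) (use True in auto)
  next
    case f: False
    then have "s < 0" using False by auto
    then have "((\<lambda>s. max 0 s ^ Suc (Suc m)) has_real_derivative 0) (at s)"
      by (intro has_field_derivative_transform_within_open[OF DERIV_const, where S="{..<0}"]) auto
    then show ?thesis using \<open>s < 0\<close> by simp
  qed
qed

lemma DERIV_bump_line:
  "((\<lambda>t. bump (Suc (Suc m)) (x + t *\<^sub>R b)) has_real_derivative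
     - 2 * (real m + 2) * (x \<bullet> b) * bump (Suc m) x) (at 0)"
proof -
  have 1: "((\<lambda>t. 1 - (x + t *\<^sub>R b) \<bullet> (x + t *\<^sub>R b)) has_real_derivative - 2 * (x \<bullet> b)) (at 0)"
  proof -
    have "(\<lambda>t. 1 - (x + t *\<^sub>R b) \<bullet> (x + t *\<^sub>R b)) = (\<lambda>t. 1 - x \<bullet> x - 2 * (x \<bullet> b) * t - (b \<bullet> b) * t\<^sup>2)"
      by (auto simp: inner_simps inner_commute power2_eq_square algebra_simps)
    then show ?thesis by (auto intro!: derivative_eq_intros)
  qed
  show ?thesis
    using DERIV_chain2[OF DERIV_max_0_power 1, of m]
    by (simp add: bump_def algebra_simps)
qed

lemma norm_le_1_imp_mem_cbox_One:
  assumes "norm x \<le> 1"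
  shows "x \<in> cbox (- One) One"
proof -
  have "\<bar>x \<bullet> i\<bar> \<le> 1" if "i \<in> Basis" for i
    using Basis_le_norm[OF that, of x] assms by linarith
  then show ?thesis
    by (auto simp: mem_box abs_le_iff inner_simps)
qed

text \<open>Nothing is known about \<open>k\<close> off \<open>S\<close>, but the product is 0
  wherever \<open>w\<close> vanishes. Continuity is glued from two open sets: the points mapped into
  \<open>S\<close>, and the exterior of the unit ball. They cover the space because the closed unit
  ball lies in the cube.\<close>

lemma continuous_on_mult_cutoff:
  fixes k w :: "'a::euclidean_space \<Rightarrow> real"
  assumes S: "open S" and k: "continuous_on S k" and w: "continuous_on UNIV w"
    and w0: "\<And>x. 1 \<le> norm x \<Longrightarrow> w x = 0"
    and inS: "\<And>x. x \<in> cbox (- One) One \<Longrightarrow> z + r *\<^sub>R x \<in> S"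
  shows "continuous_on UNIV (\<lambda>x. k (z + r *\<^sub>R x) * w x)"
proof -
  define T where "T = (\<lambda>x. z + r *\<^sub>R x) -` S"
  define U where "U = {x::'a. 1 < norm x}"
  have "open T"
    unfolding T_def using S by (intro open_vimage continuous_intros)
  moreover have "open U"
    unfolding U_def by (intro open_Collect_less continuous_intros)
  moreover have "continuous_on T (\<lambda>x. k (z + r *\<^sub>R x) * w x)"
    by (intro continuous_on_mult continuous_on_compose2[OF k] continuous_on_subset[OF w] continuous_intros)
      (auto simp: T_def)
  moreover have "continuous_on U (\<lambda>x. k (z + r *\<^sub>R x) * w x)"
    by (rule continuous_on_eq[of _ "\<lambda>x. 0"]) (auto simp: U_def w0)
  ultimately have "continuous_on (T \<union> U) (\<lambda>x. k (z + r *\<^sub>R x) * w x)"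
    by (rule continuous_on_open_Un)
  moreover have "T \<union> U = UNIV"
    using inS norm_le_1_imp_mem_cbox_One by (force simp: T_def U_def)
  ultimately show ?thesis by simp
qed

text \<open>Integration by parts in direction \<open>b\<close>: differentiating
  \<open>bump 3\<close> gives -6 times \<open>x \<bullet> b\<close> times \<open>bump 2\<close>,
  while the chain rule for \<open>z + r x\<close> supplies the factor \<open>r\<close>.\<close>

lemma integral_radial_derivative_bump:
  fixes u :: "'a::euclidean_space \<Rightarrow> real"
  assumes S: "open S" and u: "Ck 2 u S" and b: "b \<in> Basis"
    and inS: "\<And>x. x \<in> cbox (- One) One \<Longrightarrow> z + r *\<^sub>R x \<in> S"
  shows "6 * integral (cbox (- One) One) (\<lambda>x. dirD u b (z + r *\<^sub>R x) * ((x \<bullet> b) * bump 2 x)) =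
    r * integral (cbox (- One) One) (\<lambda>x. dirD (dirD u b) b (z + r *\<^sub>R x) * bump 3 x)"
proof -
  have u2: "Ck (Suc (Suc 0)) u S" using u by (simp only: numeral_2_eq_2)
  note cm = continuous_on_mult_cutoff[OF S _ _ _ inS]
  have c1: "continuous_on S (dirD u b)" by (rule Ck_continuous[OF Ck_dirD[OF u2]])
  have c2: "continuous_on S (dirD (dirD u b) b)" by (rule Ck_continuous[OF Ck_dirD[OF Ck_dirD[OF u2]]])
  define h where "h x = dirD u b (z + r *\<^sub>R x) * bump 3 x" for x
  define g1 where "g1 x = dirD (dirD u b) b (z + r *\<^sub>R x) * bump 3 x" for x
  define g2 where "g2 x = dirD u b (z + r *\<^sub>R x) * ((x \<bullet> b) * bump 2 x)" for x
  have hc: "continuous_on UNIV h"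
    unfolding h_def by (rule cm[OF c1 continuous_on_bump bump_eq_0]) auto
  have gc1: "continuous_on UNIV g1"
    unfolding g1_def by (rule cm[OF c2 continuous_on_bump bump_eq_0]) auto
  have gc2: "continuous_on UNIV g2"
    unfolding g2_def by (rule cm[OF c1]) (auto intro!: continuous_intros continuous_on_bump bump_eq_0)
  have out: "1 < norm x" if "x \<notin> cbox (- One) One" for x :: 'a
    using norm_le_1_imp_mem_cbox_One[of x] that by (cases "norm x \<le> 1") auto
  \<comment> \<open>The integrand is the derivative of \<open>h\<close> in direction
    \<open>b\<close>, and both vanish outside the cube.\<close>
  have "integral (cbox (- One) One) (\<lambda>x. r * g1 x - 6 * g2 x) = 0"
  proof (rule integral_directional_derivative_eq_0[OF _ b _ hc])
    show "((\<lambda>t. h (x + t *\<^sub>R b)) has_real_derivative r * g1 x - 6 * g2 x) (at 0)" for x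
    proof (cases "x \<in> cbox (- One) One")
      case True
      have d: "(dirD u b has_derivative (\<lambda>v. dirD (dirD u b) v (z + r *\<^sub>R x))) (at (z + r *\<^sub>R x + 0 *\<^sub>R (r *\<^sub>R b)))"
        using Ck_has_derivative[OF S Ck_dirD[OF u2] _ inS[OF True]] by simp
      have lin: "dirD (dirD u b) (r *\<^sub>R b) (z + r *\<^sub>R x) = r * dirD (dirD u b) b (z + r *\<^sub>R x)"
        using linear_cmul[OF has_derivative_linear[OF d], of r b] by simp
      have "((\<lambda>t. dirD u b (z + r *\<^sub>R (x + t *\<^sub>R b))) has_real_derivative r * dirD (dirD u b) b (z + r *\<^sub>R x)) (at 0)"
        using has_real_derivative_along_line[of "dirD u b" "z + r *\<^sub>R x" 0 "r *\<^sub>R b"] d lin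
        by (simp add: algebra_simps)
      from DERIV_mult[OF this DERIV_bump_line[of 1 x b]]
      show ?thesis
        by (simp add: h_def g1_def g2_def numeral_3_eq_3 numeral_2_eq_2 algebra_simps)
    next
      case False
      \<comment> \<open>Here \<open>z + r x\<close> may lie outside \<open>S\<close>, where
        \<open>u\<close> is uncontrolled. The cutoff makes \<open>h\<close> vanish near
        \<open>x\<close>, so the derivative is 0 all the same.\<close>
      have "((\<lambda>t. h (x + t *\<^sub>R b)) has_real_derivative 0) (at 0)"
      proof (rule has_field_derivative_transform_within_open[OF DERIV_const])
        show "open {t. 1 < norm (x + t *\<^sub>R b)}"
          by (intro open_Collect_less continuous_intros)
        show "0 \<in> {t. 1 < norm (x + t *\<^sub>R b)}" using out[OF False] by simp
      qed (simp add: h_def bump_eq_0)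
      then show ?thesis using out[OF False] by (simp add: g1_def g2_def bump_eq_0)
    qed
    show "continuous_on UNIV (\<lambda>x. r * g1 x - 6 * g2 x)"
      by (intro continuous_intros gc1 gc2)
  qed (use out in \<open>auto simp: h_def g1_def g2_def bump_eq_0 less_imp_le\<close>)
  moreover have "g1 integrable_on cbox (- One) One" "g2 integrable_on cbox (- One) One"
    by (intro integrable_continuous continuous_on_subset[OF gc1] continuous_on_subset[OF gc2] subset_UNIV)+
  ultimately show ?thesis
    by (simp add: integral_diff integrable_on_mult_right g1_def[abs_def] g2_def[abs_def])
qed

text \<open>The weighted mean \<phi> is nondecreasing in the radius, and at radius 0 it equals
  \<open>u z\<close> times the mass of the weight. Integration by parts turns its derivative into a
  nonnegative multiple of an integral of the Laplacian against \<open>bump 3\<close>.\<close>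

lemma subharmonic_mean_value_le:
  fixes u :: "'a::euclidean_space \<Rightarrow> real"
  assumes S: "open S" and u: "Ck 2 u S" and sub: "\<And>x. x \<in> S \<Longrightarrow> 0 \<le> basis_laplacian u x"
    and \<rho>: "0 \<le> \<rho>"
    and inS: "\<And>r x. 0 \<le> r \<Longrightarrow> r \<le> \<rho> \<Longrightarrow> x \<in> cbox (- One) One \<Longrightarrow> z + r *\<^sub>R x \<in> S"
  shows "u z * integral (cbox (- One) One) (bump 2 :: 'a \<Rightarrow> real) \<le>
    integral (cbox (- One) One) (\<lambda>x. u (z + \<rho> *\<^sub>R x) * bump 2 x)"
proof -
  let ?Q = "cbox (- One) One :: 'a set"
  have u2: "Ck (Suc (Suc 0)) u S" using u by (simp only: numeral_2_eq_2)
  have c0: "continuous_on S u" by (rule Ck_continuous[OF u2])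
  have c1: "continuous_on S (dirD u b)" for b by (rule Ck_continuous[OF Ck_dirD[OF u2]])
  have c2: "continuous_on S (dirD (dirD u b) b)" for b by (rule Ck_continuous[OF Ck_dirD[OF Ck_dirD[OF u2]]])
  define \<phi> where "\<phi> r = integral ?Q (\<lambda>x. u (z + r *\<^sub>R x) * bump 2 x)" for r
  define \<psi> where "\<psi> r x = (\<Sum>b\<in>Basis. dirD u b (z + r *\<^sub>R x) * ((x \<bullet> b) * bump 2 x))" for r x
  have deriv: "(\<phi> has_real_derivative integral ?Q (\<psi> r)) (at r within {0..\<rho>})" if r: "r \<in> {0..\<rho>}" for r
    unfolding \<phi>_def
  proof (rule leibniz_rule_field_derivative[OF _ _ _ r])
    fix t x assume t: "t \<in> {0..\<rho>}" and x: "x \<in> ?Q"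
    have zS: "z + t *\<^sub>R x \<in> S" using inS t x by auto
    have d: "(u has_derivative (\<lambda>v. dirD u v (z + t *\<^sub>R x))) (at (z + t *\<^sub>R x))"
      by (rule Ck_has_derivative[OF S u2 _ zS]) simp
    \<comment> \<open>Linearity expands the radial derivative in the basis, so that integration by
      parts can be done one coordinate at a time.\<close>
    have "dirD u x (z + t *\<^sub>R x) = (\<Sum>b\<in>Basis. (x \<bullet> b) * dirD u b (z + t *\<^sub>R x))"
      using linear_sum[OF has_derivative_linear[OF d], of "\<lambda>b. (x \<bullet> b) *\<^sub>R b" Basis]
        linear_cmul[OF has_derivative_linear[OF d]]
      by (simp add: euclidean_representation)
    then have "dirD u x (z + t *\<^sub>R x) * bump 2 x = \<psi> t x"
      by (simp add: \<psi>_def sum_distrib_left sum_distrib_right mult_ac)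
    moreover have "((\<lambda>t. u (z + t *\<^sub>R x) * bump 2 x) has_real_derivative dirD u x (z + t *\<^sub>R x) * bump 2 x) (at t)"
      by (rule DERIV_cmult_right[OF has_real_derivative_along_line[OF d]])
    ultimately show "((\<lambda>t. u (z + t *\<^sub>R x) * bump 2 x) has_real_derivative \<psi> t x) (at t within {0..\<rho>})"
      by (simp add: has_field_derivative_at_within)
  next
    fix t assume "t \<in> {0..\<rho>}"
    then show "(\<lambda>x. u (z + t *\<^sub>R x) * bump 2 x) integrable_on ?Q"
      using inS by (intro integrable_continuous continuous_intros continuous_on_compose2[OF c0] continuous_on_bump) auto
  next
    have "continuous_on ({0..\<rho>} \<times> ?Q) (\<lambda>p. \<psi> (fst p) (snd p))"
      unfolding \<psi>_def using inS
      by (intro continuous_intros continuous_on_compose2[OF c1] continuous_on_compose2[OF continuous_on_bump[of UNIV]]) auto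
    then show "continuous_on ({0..\<rho>} \<times> ?Q) (\<lambda>(t, x). \<psi> t x)"
      by (simp add: split_beta)
  qed auto
  have nonneg: "0 \<le> integral ?Q (\<psi> r)" if r: "r \<in> {0..\<rho>}" for r
  proof -
    have inr: "z + r *\<^sub>R x \<in> S" if "x \<in> ?Q" for x using inS r that by auto
    have "6 * integral ?Q (\<psi> r) = (\<Sum>b\<in>Basis. 6 * integral ?Q (\<lambda>x. dirD u b (z + r *\<^sub>R x) * ((x \<bullet> b) * bump 2 x)))"
      unfolding \<psi>_def sum_distrib_left[symmetric] using inr
      by (subst integral_sum)
        (auto intro!: integrable_continuous continuous_intros continuous_on_compose2[OF c1] continuous_on_bump)
    also have "\<dots> = (\<Sum>b\<in>Basis. r * integral ?Q (\<lambda>x. dirD (dirD u b) b (z + r *\<^sub>R x) * bump 3 x))"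
      by (intro sum.cong refl integral_radial_derivative_bump[OF S u _ inr]) 
    also have "\<dots> = r * integral ?Q (\<lambda>x. basis_laplacian u (z + r *\<^sub>R x) * bump 3 x)"
      unfolding basis_laplacian_def sum_distrib_left[symmetric] sum_distrib_right using inr
      by (subst integral_sum)
        (auto intro!: integrable_continuous continuous_intros continuous_on_compose2[OF c2] continuous_on_bump)
    also have "\<dots> \<ge> 0"
      using r inr by (auto intro!: mult_nonneg_nonneg Henstock_Kurzweil_Integration.integral_nonneg sub bump_nonneg
          integrable_continuous continuous_intros continuous_on_bump
          continuous_on_compose2[OF Ck_continuous[OF Ck_basis_laplacian[OF S u2]]])
    finally show ?thesis by simp
  qed
  have "\<phi> 0 \<le> \<phi> \<rho>"
  proof (rule DERIV_nonneg_imp_increasing_open[OF \<rho>])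
    show "\<exists>y. (\<phi> has_real_derivative y) (at r) \<and> 0 \<le> y" if "0 < r" "r < \<rho>" for r
      using deriv[of r] nonneg[of r] that at_within_Icc_at[of 0 r \<rho>] by force
    show "continuous_on {0..\<rho>} \<phi>"
      using deriv by (meson DERIV_continuous continuous_on_eq_continuous_within)
  qed
  then show ?thesis by (simp add: \<phi>_def)
qed

subsection \<open>Growth of the gradient and of the function\<close>

lemma dist_bd_pos: "z \<in> unit_ball \<Longrightarrow> 0 < dist_bd z"
  by (simp add: unit_ball_def dist_bd_def)

lemma dist_bd_le_1: "dist_bd z \<le> 1"
  by (simp add: dist_bd_def)

lemma open_unit_ball: "open unit_ball"
  by (simp add: unit_ball_def)

text \<open>A continuous nonnegative function with integral 0 would vanish at the centre, where
  \<open>bump\<close> is 1.\<close>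

lemma integral_bump_pos: "0 < integral (cbox (- One) One) (bump 2 :: 'a::euclidean_space \<Rightarrow> real)"
proof -
  let ?Q = "cbox (- One) One :: 'a set"
  have i: "(bump 2 :: 'a \<Rightarrow> real) integrable_on ?Q"
    by (intro integrable_continuous continuous_on_bump)
  have "0 \<le> integral ?Q (bump 2)"
    by (rule Henstock_Kurzweil_Integration.integral_nonneg[OF i bump_nonneg])
  moreover have "integral ?Q (bump 2) \<noteq> 0"
  proof
    assume "integral ?Q (bump 2) = 0"
    then have "(bump 2 has_integral 0) ?Q"
      using integrable_integral[OF i] by simp
    then have "bump 2 (0::'a) = 0"
      by (rule has_integral_0_cbox_imp_0[OF continuous_on_bump bump_nonneg]) (auto simp: mem_box box_ne_empty inner_simps)
    then show False by (simp add: bump_def)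
  qed
  ultimately show ?thesis by simp
qed

text \<open>If t \<le> l, the first term suffices. Otherwise the exponent 2 - \<alpha> is
  nonpositive, so replacing t by the smaller l in that factor only increases it.\<close>

lemma square_le_powr:
  fixes t l \<alpha> :: real
  assumes "0 \<le> t" "0 < l" "2 \<le> \<alpha>"
  shows "t\<^sup>2 \<le> l\<^sup>2 + l powr (2 - \<alpha>) * t powr \<alpha>"
proof (cases "t \<le> l")
  case True
  then have "t\<^sup>2 \<le> l\<^sup>2" using assms by (intro power_mono) auto
  then show ?thesis by (simp add: add_increasing2)
next
  case False
  then have t: "l < t" "0 < t" using assms by auto
  have "t\<^sup>2 = t powr (2 - \<alpha>) * t powr \<alpha>"
    using t by (simp flip: powr_add)
  also have "\<dots> \<le> l powr (2 - \<alpha>) * t powr \<alpha>"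
    using t assms by (intro mult_right_mono powr_mono2') auto
  also have "\<dots> \<le> l\<^sup>2 + l powr (2 - \<alpha>) * t powr \<alpha>" by simp
  finally show ?thesis .
qed

lemma norm_cbox_One_le:
  assumes "x \<in> cbox (- One) One"
  shows "norm (x::'a::euclidean_space) \<le> DIM('a)"
proof -
  have "norm x \<le> (\<Sum>b\<in>Basis. \<bar>x \<bullet> b\<bar>)" by (rule norm_le_l1)
  also have "\<dots> \<le> (\<Sum>b\<in>(Basis::'a set). 1)"
    using assms by (intro sum_mono) (auto simp: mem_box inner_simps abs_le_iff minus_le_iff)
  finally show ?thesis by simp
qed

lemma continuous_on_normD:
  assumes "open S" "Ck 1 f S"
  shows "continuous_on S (normD f)"
proof -
  have "Ck (Suc 0) f S" using assms by simp
  then have "continuous_on S (dz k f)" "continuous_on S (dzbar k f)" for k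
    using Ck_dz[OF assms(1)] Ck_dzbar[OF assms(1)] Ck_continuous by blast+
  then show ?thesis
    unfolding normD_def[abs_def] by (intro continuous_intros)
qed

lemma continuous_on_dist_bd: "continuous_on S dist_bd"
  unfolding dist_bd_def[abs_def] by (intro continuous_intros)

text \<open>Near \<open>z\<close>, at scale comparable to d = d(z), the weight is at least
  (d/2)^\<gamma>, so the local integral of the \<alpha>-th power of the gradient costs d^-\<gamma>,
  and rescaling to the unit cube costs d^-N, where N is the real dimension. Taking l = d^-s in
  \<open>square_le_powr\<close> with s\<alpha> = N + \<gamma> makes both terms multiples of
  l^2.\<close>

lemma normD_growth:
  fixes f :: "complex^'n \<Rightarrow> complex"
  assumes f: "Ck 3 f unit_ball"
    and sub: "\<And>x. x \<in> unit_ball \<Longrightarrow> 0 \<le> basis_laplacian (\<lambda>z. (normD f z)\<^sup>2) x"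
    and \<alpha>: "2 \<le> \<alpha>" and \<gamma>: "0 \<le> \<gamma>"
    and int: "(\<lambda>z. dist_bd z powr \<gamma> * normD f z powr \<alpha>) integrable_on unit_ball"
    and s: "s * \<alpha> = real DIM(complex^'n) + \<gamma>"
  obtains C where "0 \<le> C" "\<And>z. z \<in> unit_ball \<Longrightarrow> normD f z \<le> C * dist_bd z powr (- s)"
proof -
  let ?Q = "cbox (- One) One :: (complex^'n) set"
  let ?N = "DIM(complex^'n)"
  define G where "G z = dist_bd z powr \<gamma> * normD f z powr \<alpha>" for z
  define I where "I = integral unit_ball G"
  define B where "B = integral ?Q (bump 2)"
  \<comment> \<open>The cube volume comes from the constant term l^2; the other factors come from
    halving d in the weight and from the Jacobian of the rescaling.\<close>
  define K where "K = measure lborel ?Q + 2 powr \<gamma> * (2 * real ?N) ^ ?N * I"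
  have f1: "Ck 1 f unit_ball" by (rule Ck_mono[OF _ f]) simp
  have nc: "continuous_on unit_ball (normD f)" by (rule continuous_on_normD[OF open_unit_ball f1])
  have Gc: "continuous_on unit_ball G"
    unfolding G_def using \<alpha> by (intro continuous_intros continuous_on_dist_bd nc continuous_on_powr')
      (auto simp: normD_nonneg dist_bd_pos less_imp_le dest!: dist_bd_pos)
  have Gint: "G integrable_on unit_ball" using int by (simp add: G_def[abs_def])
  have G0: "0 \<le> G z" for z by (simp add: G_def)
  have I0: "0 \<le> I" unfolding I_def by (rule Henstock_Kurzweil_Integration.integral_nonneg[OF Gint G0])
  have B0: "0 < B" unfolding B_def by (rule integral_bump_pos)
  have K0: "0 \<le> K" unfolding K_def by (intro add_nonneg_nonneg mult_nonneg_nonneg measure_nonneg I0) auto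
  have "normD f z \<le> sqrt (K / B) * dist_bd z powr (- s)" if z: "z \<in> unit_ball" for z
  proof -
    define d where "d = dist_bd z"
    have d: "0 < d" "d \<le> 1" using dist_bd_pos[OF z] dist_bd_le_1 by (auto simp: d_def)
    \<comment> \<open>Points of the cube have norm at most N, so moving by \<rho> times such a point
      loses at most half of the distance to the boundary.\<close>
    define \<rho> where "\<rho> = d / (2 * real ?N)"
    have \<rho>: "0 < \<rho>" using d by (simp add: \<rho>_def)
    define l where "l = d powr (- s)"
    have l: "0 < l" using d by (simp add: l_def)
    have near: "dist_bd (z + r *\<^sub>R x) \<ge> d / 2" "z + r *\<^sub>R x \<in> unit_ball"
      if "0 \<le> r" "r \<le> \<rho>" "x \<in> ?Q" for r x
    proof -
      have "norm (z + r *\<^sub>R x) \<le> norm z + r * norm x"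
        using norm_triangle_ineq[of z "r *\<^sub>R x"] that by simp
      moreover have "r * norm x \<le> \<rho> * ?N"
        using that norm_cbox_One_le[OF that(3)] by (intro mult_mono) auto
      then have "r * norm x \<le> d / 2" by (simp add: \<rho>_def)
      ultimately show "dist_bd (z + r *\<^sub>R x) \<ge> d / 2" unfolding d_def dist_bd_def by (simp add: field_simps)
      with d show "z + r *\<^sub>R x \<in> unit_ball" by (simp add: unit_ball_def dist_bd_def)
    qed
    note near\<rho> = near[of \<rho>, OF less_imp_le[OF \<rho>] order_refl]
    have nint: "continuous_on ?Q (\<lambda>x. normD f (z + \<rho> *\<^sub>R x))"
      using near\<rho> by (intro continuous_on_compose2[OF nc] continuous_intros) auto
    have Gint1: "continuous_on ?Q (\<lambda>x. G (z + \<rho> *\<^sub>R x))"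
      using near\<rho> by (intro continuous_on_compose2[OF Gc] continuous_intros) auto
    have npint: "continuous_on ?Q (\<lambda>x. normD f (z + \<rho> *\<^sub>R x) powr \<alpha>)"
      using \<alpha> by (intro continuous_on_powr' nint continuous_intros) (auto simp: normD_nonneg)
    let ?R = "cbox (z - \<rho> *\<^sub>R One) (z + \<rho> *\<^sub>R One)"
    have Rsub: "?R \<subseteq> unit_ball"
    proof
      fix y assume y: "y \<in> ?R"
      have "(1 / \<rho>) *\<^sub>R (y - z) \<in> ?Q"
        using y \<rho> by (auto simp: mem_box inner_simps divide_simps algebra_simps)
      from near\<rho>(2)[OF this] \<rho> show "y \<in> unit_ball" by simp
    qed
    \<comment> \<open>The substitution y = z + \<rho> x contributes the Jacobian; the small cube
      around \<open>z\<close> is then enlarged to the whole ball.\<close>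
    have "integral ?Q (\<lambda>x. G (z + \<rho> *\<^sub>R x)) = integral ?R G / \<rho> ^ ?N"
    proof (rule integral_unique)
      have "(G has_integral integral ?R G) ?R"
        by (intro integrable_integral integrable_continuous continuous_on_subset[OF Gc Rsub])
      from has_integral_affinity'[OF this \<rho>, of z] \<rho>
      show "((\<lambda>x. G (z + \<rho> *\<^sub>R x)) has_integral integral ?R G / \<rho> ^ ?N) ?Q"
        by (simp add: add.commute divide_inverse mult.commute)
    qed
    also have "\<dots> \<le> I / \<rho> ^ ?N"
      unfolding I_def using \<rho> G0 Gint Rsub
      by (intro divide_right_mono integral_subset_le integrable_continuous continuous_on_subset[OF Gc Rsub]) auto
    finally have GI: "integral ?Q (\<lambda>x. G (z + \<rho> *\<^sub>R x)) \<le> I / \<rho> ^ ?N" .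
    define J where "J = integral ?Q (\<lambda>x. normD f (z + \<rho> *\<^sub>R x) powr \<alpha>)"
    have "(normD f z)\<^sup>2 * B \<le> integral ?Q (\<lambda>x. (normD f (z + \<rho> *\<^sub>R x))\<^sup>2 * bump 2 x)"
      unfolding B_def
      by (rule subharmonic_mean_value_le[OF open_unit_ball Ck_normD_square[OF open_unit_ball f] sub less_imp_le[OF \<rho>] near(2)])
    also have "\<dots> \<le> integral ?Q (\<lambda>x. l\<^sup>2 + l powr (2 - \<alpha>) * normD f (z + \<rho> *\<^sub>R x) powr \<alpha>)"
    proof (rule integral_le)
      fix x assume "x \<in> ?Q"
      have "(normD f (z + \<rho> *\<^sub>R x))\<^sup>2 * bump 2 x \<le> (normD f (z + \<rho> *\<^sub>R x))\<^sup>2"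
        by (rule mult_left_le[OF bump_le_1]) simp
      also note square_le_powr[OF normD_nonneg l \<alpha>]
      finally show "(normD f (z + \<rho> *\<^sub>R x))\<^sup>2 * bump 2 x \<le> l\<^sup>2 + l powr (2 - \<alpha>) * normD f (z + \<rho> *\<^sub>R x) powr \<alpha>" .
    qed (intro integrable_continuous continuous_intros nint npint continuous_on_bump)+
    also have "\<dots> = measure lborel ?Q * l\<^sup>2 + l powr (2 - \<alpha>) * J"
      unfolding J_def by (subst integral_add) (auto intro!: integrable_continuous continuous_intros npint)
    finally have u: "(normD f z)\<^sup>2 * B \<le> measure lborel ?Q * l\<^sup>2 + l powr (2 - \<alpha>) * J" .
    have "J \<le> integral ?Q (\<lambda>x. (d / 2) powr (- \<gamma>) * G (z + \<rho> *\<^sub>R x))"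
      unfolding J_def
    proof (rule integral_le)
      fix x assume "x \<in> ?Q"
      have "1 = (d / 2) powr (- \<gamma>) * (d / 2) powr \<gamma>" using d by (simp flip: powr_add)
      also have "\<dots> \<le> (d / 2) powr (- \<gamma>) * dist_bd (z + \<rho> *\<^sub>R x) powr \<gamma>"
        using near\<rho>(1)[OF \<open>x \<in> ?Q\<close>] d \<gamma> by (intro mult_left_mono powr_mono2) auto
      finally have "1 * normD f (z + \<rho> *\<^sub>R x) powr \<alpha> \<le>
          ((d / 2) powr (- \<gamma>) * dist_bd (z + \<rho> *\<^sub>R x) powr \<gamma>) * normD f (z + \<rho> *\<^sub>R x) powr \<alpha>"
        by (rule mult_right_mono) simp
      then show "normD f (z + \<rho> *\<^sub>R x) powr \<alpha> \<le> (d / 2) powr (- \<gamma>) * G (z + \<rho> *\<^sub>R x)"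
        by (simp add: G_def mult_ac)
    qed (intro integrable_continuous continuous_intros npint Gint1)+
    also have "\<dots> = (d / 2) powr (- \<gamma>) * integral ?Q (\<lambda>x. G (z + \<rho> *\<^sub>R x))" by simp
    also have "\<dots> \<le> (d / 2) powr (- \<gamma>) * (I / \<rho> ^ ?N)" by (intro mult_left_mono GI) simp
    also have "\<dots> = 2 powr \<gamma> * (2 * real ?N) ^ ?N * I * l powr \<alpha>"
    proof -
      \<comment> \<open>The relation s\<alpha> = N + \<gamma> makes the two losses in d combine to
        exactly l^\<alpha>.\<close>
      have "l powr \<alpha> = d powr (- \<gamma>) * d powr (- real ?N)"
        using s unfolding l_def powr_powr powr_add[symmetric] by (simp add: algebra_simps)
      moreover have "(d / 2) powr (- \<gamma>) = d powr (- \<gamma>) * 2 powr \<gamma>"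
        using d by (simp add: powr_divide powr_minus field_simps)
      moreover have "1 / \<rho> ^ ?N = (2 * real ?N) ^ ?N * d powr (- real ?N)"
      proof -
        have "1 / (d / (2 * real n)) ^ n = (2 * real n) ^ n * d powr (- real n)" for n
          unfolding powr_minus powr_realpow[OF d(1)] power_divide divide_inverse[of 1] divide_inverse[of "d ^ n"]
            inverse_mult_distrib inverse_inverse_eq by (simp only: mult_1_left mult.commute)
        then show ?thesis by (simp only: \<rho>_def)
      qed
      moreover have "(d / 2) powr (- \<gamma>) * (I / \<rho> ^ ?N) = (d / 2) powr (- \<gamma>) * I * (1 / \<rho> ^ ?N)" by simp
      ultimately show ?thesis by (simp only: mult_ac)
    qed
    finally have "l powr (2 - \<alpha>) * J \<le> l powr (2 - \<alpha>) * (2 powr \<gamma> * (2 * real ?N) ^ ?N * I * l powr \<alpha>)"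
      by (rule mult_left_mono) simp
    moreover have "measure lborel ?Q * l\<^sup>2 + l powr (2 - \<alpha>) * (2 powr \<gamma> * (2 * real ?N) ^ ?N * I * l powr \<alpha>) = K * l\<^sup>2"
    proof -
      have "l powr (2 - \<alpha>) * l powr \<alpha> = l\<^sup>2" using l by (simp flip: powr_add)
      then show ?thesis by (simp add: K_def algebra_simps)
    qed
    ultimately have "(normD f z)\<^sup>2 * B \<le> K * l\<^sup>2" using u by linarith
    then have "(normD f z)\<^sup>2 \<le> K / B * l\<^sup>2" using B0 by (simp add: field_simps)
    then have "normD f z \<le> sqrt (K / B * l\<^sup>2)" by (rule real_le_rsqrt)
    also have "\<dots> = sqrt (K / B) * l" unfolding real_sqrt_mult using l by simp
    finally show ?thesis by (simp add: l_def d_def)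
  qed
  then show ?thesis using that[of "sqrt (K / B)"] K0 B0 by simp
qed

lemma norm_dirD_le_normD:
  fixes f :: "complex^'n \<Rightarrow> complex"
  assumes "f differentiable at z"
  shows "norm (dirD f v z) \<le> 2 * real DIM(complex^'n) * norm v * normD f z"
proof -
  have b: "norm (dirD f b z) \<le> 2 * normD f z" if "b \<in> Basis" for b
  proof (rule power2_le_imp_le)
    have "(norm (dirD f b z))\<^sup>2 \<le> (\<Sum>b\<in>Basis. (norm (dirD f b z))\<^sup>2)"
      using that by (intro member_le_sum) auto
    also have "\<dots> \<le> (2 * normD f z)\<^sup>2"
      unfolding sum_norm_dirD_square by (simp add: power_mult_distrib)
    finally show "(norm (dirD f b z))\<^sup>2 \<le> (2 * normD f z)\<^sup>2" .
  qed (simp add: normD_nonneg)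
  have lin: "linear (\<lambda>v. dirD f v z)"
    by (rule has_derivative_linear[OF has_derivative_dirD[OF assms]])
  have "dirD f v z = (\<Sum>b\<in>Basis. (v \<bullet> b) *\<^sub>R dirD f b z)"
    using linear_sum[OF lin, of "\<lambda>b. (v \<bullet> b) *\<^sub>R b" Basis] linear_cmul[OF lin]
    by (simp add: euclidean_representation)
  also have "norm \<dots> \<le> (\<Sum>b\<in>(Basis::(complex^'n) set). norm v * (2 * normD f z))"
    by (intro sum_norm_le) (auto intro!: mult_mono b Basis_le_norm)
  finally show ?thesis by (simp add: mult_ac)
qed

text \<open>On the segment from 0 to \<open>z\<close> the speed of \<open>f\<close> is at most
  K\<bar>z\<bar>(1 - t\<bar>z\<bar>)^-(q+1), whose primitive in t is K/q times (1 -
  t\<bar>z\<bar>)^-q. Positivity of \<open>q\<close> is what improves the exponent by one.\<close>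

lemma norm_growth:
  fixes f :: "complex^'n \<Rightarrow> complex"
  assumes f: "Ck 1 f unit_ball" and q: "0 < q" and C: "0 \<le> C"
    and bd: "\<And>z. z \<in> unit_ball \<Longrightarrow> normD f z \<le> C * dist_bd z powr (- (q + 1))"
  obtains B where "0 < B" "\<And>z. z \<in> unit_ball \<Longrightarrow> norm (f z) \<le> B * dist_bd z powr (- q)"
proof -
  define K where "K = 2 * real DIM(complex^'n) * C"
  have K: "0 \<le> K" using C by (simp add: K_def)
  \<comment> \<open>K/q is the constant of the primitive. The value at 0 is absorbed because d^-q
    \<ge> 1, and the summand 1 makes the constant strictly positive.\<close>
  have "norm (f z) \<le> (norm (f 0) + K / q + 1) * dist_bd z powr (- q)" if z: "z \<in> unit_ball" for z
  proof -
    have nz: "norm z < 1" using z by (simp add: unit_ball_def)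
    have lt: "t * norm z < 1" if "0 \<le> t" "t \<le> 1" for t
      using mult_left_le_one_le[of "norm z" t] that nz by auto
    have inb: "t *\<^sub>R z \<in> unit_ball" "dist_bd (t *\<^sub>R z) = 1 - t * norm z" if "0 \<le> t" "t \<le> 1" for t
      using lt[OF that] that by (auto simp: unit_ball_def dist_bd_def)
    define \<phi> where "\<phi> t = K / q * (1 - t * norm z) powr (- q)" for t
    have der: "((\<lambda>t. f (t *\<^sub>R z)) has_vector_derivative dirD f z (t *\<^sub>R z)) (at t)" if t: "0 \<le> t" "t \<le> 1" for t
    proof -
      have d: "(f has_derivative (\<lambda>v. dirD f v (t *\<^sub>R z))) (at (t *\<^sub>R z))"
        by (rule Ck_has_derivative[OF open_unit_ball f _ inb(1)[OF t]]) simp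
      have 1: "((\<lambda>t. t *\<^sub>R z) has_derivative (\<lambda>h. h *\<^sub>R z)) (at t)"
        by (auto intro!: derivative_eq_intros)
      show ?thesis
        unfolding has_vector_derivative_def
        using has_derivative_compose[OF 1 d] linear_cmul[OF has_derivative_linear[OF d]] by simp
    qed
    have "norm (f (1 *\<^sub>R z) - f (0 *\<^sub>R z)) \<le> \<phi> 1 - \<phi> 0"
    proof (rule differentiable_bound_general[OF zero_less_one])
      show "continuous_on {0..1} (\<lambda>t. f (t *\<^sub>R z))"
        using has_vector_derivative_continuous[OF der] by (intro continuous_at_imp_continuous_on) auto
      show "continuous_on {0..1} \<phi>"
        unfolding \<phi>_def using lt by (intro continuous_intros) force
      show "((\<lambda>t. f (t *\<^sub>R z)) has_vector_derivative dirD f z (t *\<^sub>R z)) (at t)" if "0 < t" "t < 1" for t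
        using der that by simp
      show "(\<phi> has_vector_derivative K * norm z * (1 - t * norm z) powr (- (q + 1))) (at t)" if "0 < t" "t < 1" for t
      proof -
        have "((\<lambda>t. (1 - t * norm z) powr (- q)) has_real_derivative
            (- q) * (1 - t * norm z) powr (- q - 1) * (- norm z)) (at t)"
          by (rule DERIV_fun_powr[where g="\<lambda>t. 1 - t * norm z" and r="-q", THEN DERIV_cong])
            (use lt[of t] that in \<open>auto intro!: derivative_eq_intros\<close>)
        then have "(\<phi> has_real_derivative K / q * ((- q) * (1 - t * norm z) powr (- q - 1) * (- norm z))) (at t)"
          unfolding \<phi>_def by (rule DERIV_cmult)
        moreover have "- (q + 1) = - q - 1" by simp
        ultimately show ?thesis
          unfolding has_real_derivative_iff_has_vector_derivative[symmetric] using q by (simp add: mult_ac)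
      qed
      show "norm (dirD f z (t *\<^sub>R z)) \<le> K * norm z * (1 - t * norm z) powr (- (q + 1))" if "0 < t" "t < 1" for t
      proof -
        have t: "0 \<le> t" "t \<le> 1" using that by auto
        have "norm (dirD f z (t *\<^sub>R z)) \<le> 2 * real DIM(complex^'n) * norm z * normD f (t *\<^sub>R z)"
          by (rule norm_dirD_le_normD) (rule Ck_differentiable[OF open_unit_ball f _ inb(1)[OF t]], simp)
        also have "\<dots> \<le> 2 * real DIM(complex^'n) * norm z * (C * (1 - t * norm z) powr (- (q + 1)))"
          using bd[OF inb(1)[OF t]] inb(2)[OF t] by (intro mult_left_mono) auto
        finally show ?thesis by (simp add: K_def mult_ac)
      qed
    qed
    also have "\<phi> 1 - \<phi> 0 \<le> K / q * dist_bd z powr (- q)"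
      using K q by (simp add: \<phi>_def dist_bd_def)
    finally have 1: "norm (f z - f 0) \<le> K / q * dist_bd z powr (- q)" by simp
    have "1 \<le> dist_bd z powr (- q)"
      using dist_bd_pos[OF z] dist_bd_le_1[of z] q by (simp add: ge_one_powr_ge_zero powr_minus one_le_inverse powr_le1)
    then have "norm (f 0) * 1 + 1 * 1 \<le> norm (f 0) * dist_bd z powr (- q) + 1 * dist_bd z powr (- q)"
      by (intro add_mono mult_mono) auto
    moreover have "norm (f z) \<le> norm (f z - f 0) + norm (f 0)" by (metis diff_add_cancel norm_triangle_ineq)
    ultimately show ?thesis using 1 by (simp add: algebra_simps)
  qed
  then show ?thesis using that[of "norm (f 0) + K / q + 1"] K q by (simp add: add_nonneg_pos)
qed

subsection \<open>The Laplacian of a power of the modulus\<close>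

text \<open>The gradient of \<bar>w\<bar>^p divided by p, for p \<ge> 2. When p = 2 the value
  \<open>0 powr 0 = 0\<close> is harmless here, since it multiplies the zero vector.\<close>

definition norm_pow_map :: "real \<Rightarrow> 'a::real_inner \<Rightarrow> 'a" where
  "norm_pow_map p w = norm w powr (p - 2) *\<^sub>R w"

text \<open>The case \<open>p = 2\<close> is separate because \<open>0 powr 0 = 0\<close>, which would give the wrong derivative at the origin.\<close>

definition norm_pow_map_deriv :: "real \<Rightarrow> 'a::real_inner \<Rightarrow> 'a \<Rightarrow> 'a" where
  "norm_pow_map_deriv p w h = (if p = 2 then h else
     norm w powr (p - 2) *\<^sub>R h + ((p - 2) * norm w powr (p - 4) * (w \<bullet> h)) *\<^sub>R w)"

lemma has_derivative_norm_powr_nonzero: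
  fixes w :: "'a::real_inner"
  assumes "w \<noteq> 0"
  shows "((\<lambda>w. norm w powr e) has_derivative (\<lambda>h. e * norm w powr (e - 2) * (w \<bullet> h))) (at w)"
proof -
  have n: "(norm has_derivative (\<lambda>h. h \<bullet> sgn w)) (at w)"
    using GDERIV_norm[OF assms] by (simp add: gderiv_def)
  have "((\<lambda>w. norm w powr e) has_derivative (\<lambda>h. norm w powr e * (0 * ln (norm w) + (h \<bullet> sgn w) * e / norm w))) (at w)"
    using assms by (intro has_derivative_powr n has_derivative_const) auto
  moreover have "norm w powr e * (0 * ln (norm w) + (h \<bullet> sgn w) * e / norm w) = e * norm w powr (e - 2) * (w \<bullet> h)" for h
    using assms by (simp add: powr_diff sgn_div_norm inner_commute power2_eq_square field_simps)
  ultimately show ?thesis by simp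
qed

lemma tendsto_norm_powr_0:
  "0 < e \<Longrightarrow> ((\<lambda>h::'a::real_normed_vector. norm h powr e) \<longlongrightarrow> 0) (at 0)"
  by (rule tendsto_zero_powrI[OF _ tendsto_const]) (auto intro: tendsto_norm_zero)

lemma has_derivative_norm_powr:
  fixes w :: "'a::real_inner"
  assumes "2 \<le> p"
  shows "((\<lambda>w. norm w powr p) has_derivative (\<lambda>h. p * (norm_pow_map p w \<bullet> h))) (at w)"
proof (cases "w = 0")
  case True
  have "((\<lambda>h::'a. norm h powr (p - 1)) \<longlongrightarrow> 0) (at 0)"
    using assms by (intro tendsto_norm_powr_0) simp
  moreover have "norm (norm h powr p) / norm h = norm h powr (p - 1)" for h :: 'a
    by (cases "h = 0") (auto simp: powr_diff)
  ultimately show ?thesis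
    using True assms by (simp add: has_derivative_at norm_pow_map_def bounded_linear_zero)
next
  case False
  then show ?thesis
    using has_derivative_norm_powr_nonzero[OF False, of p] by (simp add: norm_pow_map_def mult_ac)
qed

lemma has_derivative_norm_pow_map:
  fixes w :: "'a::real_inner"
  assumes "2 \<le> p"
  shows "(norm_pow_map p has_derivative norm_pow_map_deriv p w) (at w)"
proof (cases "p = 2")
  case True
  have "norm_pow_map p = (\<lambda>w::'a. w)" using True by (auto simp: norm_pow_map_def fun_eq_iff)
  moreover have "norm_pow_map_deriv p w = (\<lambda>h. h)" using True by (auto simp: norm_pow_map_deriv_def fun_eq_iff)
  ultimately show ?thesis by simp
next
  case p: False
  show ?thesis
  proof (cases "w = 0")
    case True
    have "((\<lambda>h::'a. norm h powr (p - 2)) \<longlongrightarrow> 0) (at 0)"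
      using assms p by (intro tendsto_norm_powr_0) simp
    moreover have "norm (norm_pow_map p h) / norm h = norm h powr (p - 2)" for h :: 'a
      by (cases "h = 0") (auto simp: norm_pow_map_def)
    moreover have "norm_pow_map_deriv p w = (\<lambda>h. 0)" using True p by (auto simp: norm_pow_map_deriv_def)
    moreover have "norm_pow_map p (0::'a) = 0" by (simp add: norm_pow_map_def)
    ultimately show ?thesis
      using True by (simp add: has_derivative_at bounded_linear_zero)
  next
    case False
    have "((\<lambda>w. norm w powr (p - 2) *\<^sub>R w) has_derivative
       (\<lambda>h. norm w powr (p - 2) *\<^sub>R h + ((p - 2) * norm w powr (p - 2 - 2) * (w \<bullet> h)) *\<^sub>R w)) (at w)"
      by (intro has_derivative_scaleR has_derivative_norm_powr_nonzero False has_derivative_ident)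
    then show ?thesis
      using p by (simp add: norm_pow_map_deriv_def[abs_def] norm_pow_map_def[abs_def])
  qed
qed

lemma norm_norm_pow_map: "norm (norm_pow_map p w) = norm w powr (p - 1)"
  by (cases "w = 0") (auto simp: norm_pow_map_def powr_diff power2_eq_square field_simps)

text \<open>By Cauchy-Schwarz the second term adds p - 2 copies of the bound for the first.
  \<open>B\<close> is kept positive because for p = 2 the right-hand side at B = 0 would be
  0.\<close>

lemma norm_norm_pow_map_deriv_le:
  fixes w :: "'a::real_inner"
  assumes p: "2 \<le> p" and B: "0 < B" "norm w \<le> B"
  shows "norm (norm_pow_map_deriv p w h) \<le> (p - 1) * B powr (p - 2) * norm h"
proof (cases "p = 2 \<or> w = 0")
  case True
  then show ?thesis using p B by (auto simp: norm_pow_map_deriv_def)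
next
  case False
  have "norm (norm_pow_map_deriv p w h) \<le> norm w powr (p - 2) * norm h + (p - 2) * norm w powr (p - 4) * \<bar>w \<bullet> h\<bar> * norm w"
    unfolding norm_pow_map_deriv_def using False p
    by (auto intro!: order_trans[OF norm_triangle_ineq] simp: abs_mult)
  also have "\<dots> \<le> norm w powr (p - 2) * norm h + (p - 2) * norm w powr (p - 4) * (norm w * norm h) * norm w"
    using p by (intro add_left_mono mult_right_mono mult_left_mono Cauchy_Schwarz_ineq2) auto
  also have "\<dots> = norm w powr (p - 2) * norm h + (p - 2) * (norm w powr (p - 4) * (norm w)\<^sup>2) * norm h"
    by (simp add: power2_eq_square mult_ac)
  also have "norm w powr (p - 4) * (norm w)\<^sup>2 = norm w powr (p - 2)"
    using powr_add[of "norm w" "p - 4" 2] False by simp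
  also have "norm w powr (p - 2) * norm h + (p - 2) * norm w powr (p - 2) * norm h = (p - 1) * norm w powr (p - 2) * norm h"
    by (simp add: algebra_simps)
  also have "\<dots> \<le> (p - 1) * B powr (p - 2) * norm h"
    using p B by (intro mult_right_mono mult_left_mono powr_mono2) auto
  finally show ?thesis .
qed

lemma has_derivative_norm_powr_comp:
  fixes f :: "'a::real_normed_vector \<Rightarrow> 'b::real_inner"
  assumes p: "2 \<le> p" and f: "f differentiable at z"
  shows "((\<lambda>x. norm (f x) powr p) has_derivative (\<lambda>v. p * (norm_pow_map p (f z) \<bullet> dirD f v z))) (at z)"
  using has_derivative_compose[OF has_derivative_dirD[OF f] has_derivative_norm_powr[OF p]] .

text \<open>For p \<ge> 2 the map \<open>norm_pow_map p\<close> is differentiable at the origin too,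
  so the second derivative of \<bar>f\<bar>^p is computed directly even at zeros of
  \<open>f\<close>, with no regularization.\<close>

lemma has_derivative_dirD_norm_powr:
  fixes f :: "'a::real_normed_vector \<Rightarrow> 'b::real_inner"
  assumes p: "2 \<le> p" and S: "open S" and f: "Ck 2 f S" and z: "z \<in> S"
  shows "(dirD (\<lambda>x. norm (f x) powr p) v has_derivative
    (\<lambda>w. p * (norm_pow_map p (f z) \<bullet> dirD (dirD f v) w z + norm_pow_map_deriv p (f z) (dirD f w z) \<bullet> dirD f v z))) (at z)"
proof (rule has_derivative_transform_within_open[OF _ S z])
  have f2: "Ck (Suc (Suc 0)) f S" using f by (simp only: numeral_2_eq_2)
  have 1: "((\<lambda>x. norm_pow_map p (f x)) has_derivative (\<lambda>w. norm_pow_map_deriv p (f z) (dirD f w z))) (at z)"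
    by (rule has_derivative_compose[OF Ck_has_derivative[OF S f2 _ z] has_derivative_norm_pow_map[OF p]]) simp
  have 2: "(dirD f v has_derivative (\<lambda>w. dirD (dirD f v) w z)) (at z)"
    by (rule Ck_has_derivative[OF S Ck_dirD[OF f2] _ z]) simp
  show "((\<lambda>x. p * (norm_pow_map p (f x) \<bullet> dirD f v x)) has_derivative
    (\<lambda>w. p * (norm_pow_map p (f z) \<bullet> dirD (dirD f v) w z + norm_pow_map_deriv p (f z) (dirD f w z) \<bullet> dirD f v z))) (at z)"
    by (intro has_derivative_mult_right has_derivative_inner 1 2)
  show "p * (norm_pow_map p (f x) \<bullet> dirD f v x) = dirD (\<lambda>x. norm (f x) powr p) v x" if "x \<in> S" for x
    by (rule dirD_eqI[symmetric], rule has_derivative_norm_powr_comp[OF p], rule Ck_differentiable[OF S f2 _ that]) simp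
qed

lemma basis_laplacian_norm_powr:
  fixes f :: "'a::euclidean_space \<Rightarrow> 'b::real_inner"
  assumes "2 \<le> p" "open S" "Ck 2 f S" "z \<in> S"
  shows "basis_laplacian (\<lambda>x. norm (f x) powr p) z =
    p * (norm_pow_map p (f z) \<bullet> basis_laplacian f z +
      (\<Sum>v\<in>Basis. norm_pow_map_deriv p (f z) (dirD f v z) \<bullet> dirD f v z))"
  unfolding basis_laplacian_def dirD_eqI[OF has_derivative_dirD_norm_powr[OF assms]]
  by (simp add: sum_distrib_left[symmetric] sum.distrib inner_sum_right)

text \<open>For real \<open>g\<close> the mixed second derivatives carry a factor i and vanish under
  \<open>Re\<close>. This permits second-order differentiability at the single point
  \<open>z\<close> as the assumption, which is what is established for \<bar>f\<bar>^p.\<close>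

lemma Re_laplacian_of_real:
  fixes g :: "complex^'n \<Rightarrow> real"
  assumes S: "open S" and z: "z \<in> S" and g: "\<And>x. x \<in> S \<Longrightarrow> g differentiable at x"
    and g2: "\<And>v. dirD g v differentiable at z"
  shows "Re (laplacian (\<lambda>x. complex_of_real (g x)) z) = basis_laplacian g z"
proof -
  let ?G = "\<lambda>x. complex_of_real (g x)"
  have 1: "dirD ?G v x = complex_of_real (dirD g v x)" if "x \<in> S" for v x
    by (rule dirD_bounded_linear[OF bounded_linear_of_real g[OF that]])
  have 2: "dirD (dirD ?G v) w z = complex_of_real (dirD (dirD g v) w z)" for v w
    by (rule trans[OF dirD_cong[OF S z 1] dirD_bounded_linear[OF bounded_linear_of_real g2]])
  have d: "dirD ?G v differentiable at z" for v
  proof -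
    have "((\<lambda>x. complex_of_real (dirD g v x)) has_derivative (\<lambda>w. complex_of_real (dirD (dirD g v) w z))) (at z)"
      by (rule bounded_linear.has_derivative[OF bounded_linear_of_real has_derivative_dirD[OF g2]])
    then have "(dirD ?G v has_derivative (\<lambda>w. complex_of_real (dirD (dirD g v) w z))) (at z)"
      by (rule has_derivative_transform_within_open[OF _ S z]) (simp add: 1)
    then show ?thesis by (rule differentiableI)
  qed
  have "Re (4 * dz k (dzbar k ?G) z) = dirD (dirD g (axis k 1)) (axis k 1) z + dirD (dirD g (axis k \<i>)) (axis k \<i>) z" for k
    unfolding dz_eq dzbar_eq dirD_combination[OF d d] 2 by simp
  then show ?thesis
    by (simp add: laplacian_def basis_laplacian_def sum_Basis_complex_vec sum_distrib_left Re_sum del: Re_divide_numeral)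
qed

lemma Re_laplacian_norm_powr:
  fixes f :: "complex^'n \<Rightarrow> complex"
  assumes p: "2 \<le> p" and S: "open S" and f: "Ck 2 f S" and z: "z \<in> S"
  shows "Re (laplacian (\<lambda>x. complex_of_real (norm (f x) powr p)) z) =
    p * (norm_pow_map p (f z) \<bullet> laplacian f z +
      (\<Sum>v\<in>Basis. norm_pow_map_deriv p (f z) (dirD f v z) \<bullet> dirD f v z))"
proof -
  have "Re (laplacian (\<lambda>x. complex_of_real (norm (f x) powr p)) z) = basis_laplacian (\<lambda>x. norm (f x) powr p) z"
  proof (rule Re_laplacian_of_real[OF S z])
    show "(\<lambda>x. norm (f x) powr p) differentiable at x" if "x \<in> S" for x
      using has_derivative_norm_powr_comp[OF p Ck_differentiable[OF S f _ that]] by (auto simp: differentiable_def)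
    show "dirD (\<lambda>x. norm (f x) powr p) v differentiable at z" for v
      using has_derivative_dirD_norm_powr[OF p S f z] by (auto simp: differentiable_def)
  qed
  then show ?thesis
    by (simp add: basis_laplacian_norm_powr[OF p S f z] laplacian_eq_basis_laplacian[OF S f z])
qed

text \<open>Cauchy-Schwarz on both terms. \<open>B\<close> may depend on the point, so the growth
  bound for \<open>f\<close> can be inserted later.\<close>

lemma abs_Re_laplacian_norm_powr_le:
  fixes f :: "complex^'n \<Rightarrow> complex"
  assumes p: "2 \<le> p" and S: "open S" and f: "Ck 2 f S" and z: "z \<in> S"
    and B: "0 < B" "norm (f z) \<le> B"
  shows "\<bar>Re (laplacian (\<lambda>x. complex_of_real (norm (f x) powr p)) z)\<bar> \<le>
    p * (B powr (p - 1) * norm (laplacian f z) + 2 * (p - 1) * B powr (p - 2) * (normD f z)\<^sup>2)"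
proof -
  have "\<bar>norm_pow_map p (f z) \<bullet> laplacian f z\<bar> \<le> norm (f z) powr (p - 1) * norm (laplacian f z)"
    using Cauchy_Schwarz_ineq2[of "norm_pow_map p (f z)"] by (simp only: norm_norm_pow_map)
  also have "\<dots> \<le> B powr (p - 1) * norm (laplacian f z)"
    using p B by (intro mult_right_mono powr_mono2) auto
  finally have 1: "\<bar>norm_pow_map p (f z) \<bullet> laplacian f z\<bar> \<le> B powr (p - 1) * norm (laplacian f z)" .
  have "\<bar>\<Sum>v\<in>Basis. norm_pow_map_deriv p (f z) (dirD f v z) \<bullet> dirD f v z\<bar>
      \<le> (\<Sum>v\<in>Basis. (p - 1) * B powr (p - 2) * (norm (dirD f v z))\<^sup>2)"
  proof (rule order_trans[OF sum_abs sum_mono])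
    fix v :: "complex^'n"
    have "\<bar>norm_pow_map_deriv p (f z) (dirD f v z) \<bullet> dirD f v z\<bar> \<le> norm (norm_pow_map_deriv p (f z) (dirD f v z)) * norm (dirD f v z)"
      by (rule Cauchy_Schwarz_ineq2)
    also have "\<dots> \<le> (p - 1) * B powr (p - 2) * norm (dirD f v z) * norm (dirD f v z)"
      by (intro mult_right_mono norm_norm_pow_map_deriv_le p B) simp
    finally show "\<bar>norm_pow_map_deriv p (f z) (dirD f v z) \<bullet> dirD f v z\<bar> \<le> (p - 1) * B powr (p - 2) * (norm (dirD f v z))\<^sup>2"
      by (simp add: power2_eq_square mult_ac)
  qed
  also have "\<dots> = 2 * (p - 1) * B powr (p - 2) * (normD f z)\<^sup>2"
    unfolding sum_distrib_left[symmetric] sum_norm_dirD_square by simp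
  finally have 2: "\<bar>\<Sum>v\<in>Basis. norm_pow_map_deriv p (f z) (dirD f v z) \<bullet> dirD f v z\<bar> \<le> 2 * (p - 1) * B powr (p - 2) * (normD f z)\<^sup>2" .
  have "\<bar>norm_pow_map p (f z) \<bullet> laplacian f z + (\<Sum>v\<in>Basis. norm_pow_map_deriv p (f z) (dirD f v z) \<bullet> dirD f v z)\<bar>
    \<le> B powr (p - 1) * norm (laplacian f z) + 2 * (p - 1) * B powr (p - 2) * (normD f z)\<^sup>2"
    by (rule order_trans[OF abs_triangle_ineq add_mono[OF 1 2]])
  then show ?thesis
    unfolding Re_laplacian_norm_powr[OF p S f z] abs_mult using p by (simp add: mult_left_mono)
qed

subsection \<open>Integrability\<close>

lemma integrable_scale_measure_iff:
  fixes h :: "'a \<Rightarrow> 'b::{banach, second_countable_topology}"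
  assumes "c \<noteq> 0" "c \<noteq> \<infinity>"
  shows "integrable (scale_measure c M) h \<longleftrightarrow> integrable M h"
proof -
  have m: "h \<in> borel_measurable (scale_measure c M) \<longleftrightarrow> h \<in> borel_measurable M"
    by (simp cong: measurable_cong_sets)
  have "(\<integral>\<^sup>+ x. ennreal (norm (h x)) \<partial>scale_measure c M) < \<infinity> \<longleftrightarrow> (\<integral>\<^sup>+ x. ennreal (norm (h x)) \<partial>M) < \<infinity>"
    if "h \<in> borel_measurable M"
    using that assms by (subst nn_integral_scale_measure) (auto simp: ennreal_mult_less_top less_top)
  with m show ?thesis unfolding integrable_iff_bounded by blast
qed

text \<open>The normalizing factor is the reciprocal of a positive finite volume.\<close>

lemma integrable_dV_N_iff:
  fixes h :: "complex^'n \<Rightarrow> 'b::{banach, second_countable_topology}"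
  shows "integrable dV_N h \<longleftrightarrow> integrable (lebesgue_on unit_ball) h"
proof -
  have "0 < emeasure lebesgue (unit_ball :: (complex^'n) set)"
    using open_not_negligible[of "unit_ball :: (complex^'n) set"]
    by (auto simp: unit_ball_def negligible_iff_null_sets null_sets_def zero_less_iff_neq_zero)
  moreover have "emeasure lebesgue (unit_ball :: (complex^'n) set) < \<infinity>"
    using fmeasurableD2[OF lmeasurable_ball[of "0::complex^'n" 1]] by (simp add: unit_ball_def less_top)
  ultimately show ?thesis
    unfolding dV_N_def by (intro integrable_scale_measure_iff) auto
qed

lemma borel_measurable_norm_pow_map [measurable]:
  "(norm_pow_map p :: complex \<Rightarrow> complex) \<in> borel_measurable borel"
  unfolding norm_pow_map_def[abs_def] by measurable

lemma borel_measurable_norm_pow_map_deriv: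
  fixes f g :: "'c \<Rightarrow> complex"
  assumes [measurable]: "f \<in> borel_measurable M" "g \<in> borel_measurable M"
  shows "(\<lambda>x. norm_pow_map_deriv p (f x) (g x)) \<in> borel_measurable M"
  unfolding norm_pow_map_deriv_def by (cases "p = 2") (simp_all, measurable)

section \<open>Domination of the weighted Laplacian\<close>

theorem theorem1p8:
  fixes f :: "complex^'n \<Rightarrow> complex"
    and a b c :: "complex^'n \<Rightarrow> real"
    and \<alpha> \<gamma> M q p :: real
  assumes alpha: "2 \<le> \<alpha>" "\<alpha> \<le> 2 * real CARD('n)"
    and gamma: "\<gamma> > 0" and M: "M \<ge> 0"
    and q_def: "q = (2 * real CARD('n) + \<gamma>) / \<alpha> - 1"
    and fC3: "Ck 3 f unit_ball"
    and ineq: "\<forall>z\<in>unit_ball. cmod (laplacian f z) \<le> a z * normD f z + b z * cmod (f z) + c z"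
    and abc_cont: "continuous_on unit_ball a" "continuous_on unit_ball b" "continuous_on unit_ball c"
    and abc_nonneg: "\<forall>z\<in>unit_ball. a z \<ge> 0 \<and> b z \<ge> 0 \<and> c z \<ge> 0"
    and a_bdd: "bdd_above (a ` unit_ball)" and b_bdd: "bdd_above (b ` unit_ball)"
    and c_bd: "\<forall>z\<in>unit_ball. c z \<le> M * dist_bd z powr (- q)"
    and fD: "f \<in> dirichlet_space \<gamma> \<alpha>"
    and re1: "\<forall>z\<in>unit_ball. Re (f z * cnj (laplacian f z)) \<ge> 0"
    and re2: "\<forall>z\<in>unit_ball. Re (\<Sum>k\<in>UNIV. cnj (dz k f z) * dz k (laplacian f) z
                                   + cnj (dzbar k f z) * dzbar k (laplacian f) z) \<ge> 0"
    and p: "p \<ge> 2"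
  shows "integrable dV_N (\<lambda>z. dist_bd z powr (p * q)
           * Re (laplacian (\<lambda>w. complex_of_real (cmod (f w) powr p)) z))"
proof -
  let ?S = "unit_ball :: (complex^'n) set"
  let ?L = "\<lambda>z. Re (laplacian (\<lambda>w. complex_of_real (cmod (f w) powr p)) z)"
  define H where "H z = dist_bd z powr \<gamma> * normD f z powr \<alpha>" for z
  have f2: "Ck 2 f ?S" by (rule Ck_mono[OF _ fC3]) simp
  have f1: "Ck 1 f ?S" by (rule Ck_mono[OF _ fC3]) simp
  have S: "?S \<in> sets lebesgue" by (simp add: unit_ball_def)
  have H: "integrable (lebesgue_on ?S) H"
    using fD unfolding dirichlet_space_def integrable_dV_N_iff H_def[abs_def] by simp
  \<comment> \<open>The upper bound on \<alpha> enters here: it gives q \<ge> \<gamma>/\<alpha>,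
    hence also q > 0.\<close>
  have "(2 * real CARD('n)) / \<alpha> \<ge> 1" using alpha by simp
  then have q_ge: "\<gamma> / \<alpha> \<le> q" by (simp add: q_def add_divide_distrib)
  have q: "0 < q" using gamma alpha q_ge by (smt (verit) divide_pos_pos)
  have s: "(q + 1) * \<alpha> = real DIM(complex^'n) + \<gamma>"
    using alpha by (simp add: q_def mult.commute)
  have "0 \<le> basis_laplacian (\<lambda>z. (normD f z)\<^sup>2) z" if "z \<in> ?S" for z
    by (rule basis_laplacian_normD_square_nonneg[OF open_unit_ball fC3 that]) (use re2 that in blast)
  then obtain C where C: "0 \<le> C" "\<And>z. z \<in> ?S \<Longrightarrow> normD f z \<le> C * dist_bd z powr (- (q + 1))"
    using normD_growth[OF fC3 _ alpha(1) less_imp_le[OF gamma] _ s]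
      integrable_on_lebesgue_on[OF H S] unfolding H_def[abs_def] by blast
  obtain B where B: "0 < B" "\<And>z. z \<in> ?S \<Longrightarrow> norm (f z) \<le> B * dist_bd z powr (- q)"
    using norm_growth[OF f1 q C] by blast
  obtain A0 where "\<And>z. z \<in> ?S \<Longrightarrow> a z \<le> A0" using a_bdd unfolding bdd_above_def by auto
  then obtain A1 where A1: "0 \<le> A1" "\<And>z. z \<in> ?S \<Longrightarrow> a z \<le> A1" by (meson max.cobounded1 max.coboundedI2)
  obtain A0 where "\<And>z. z \<in> ?S \<Longrightarrow> b z \<le> A0" using b_bdd unfolding bdd_above_def by auto
  then obtain A2 where A2: "0 \<le> A2" "\<And>z. z \<in> ?S \<Longrightarrow> b z \<le> A2" by (meson max.cobounded1 max.coboundedI2)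
  define K1 where "K1 = p * B powr (p - 1)"
  define K2 where "K2 = p * (2 * (p - 1) * B powr (p - 2))"
  have K: "0 \<le> K1" "0 \<le> K2" using p by (auto simp: K1_def K2_def)
  have bound: "norm (dist_bd z powr (p * q) * ?L z) \<le> K1 * (A1 * (2 + H z) + A2 * B + M) + K2 * (1 + H z)"
    if z: "z \<in> ?S" for z
  proof -
    define d where "d = dist_bd z"
    have d: "0 < d" "d \<le> 1" using dist_bd_pos[OF z] dist_bd_le_1 by (auto simp: d_def)
    have dq: "d powr q * d powr (- q) = 1" using d by (simp flip: powr_add)
    \<comment> \<open>Normalized so that t^\<alpha> is the integrable density \<open>H\<close>; both
      t and t^2 are then controlled by a constant plus \<open>H\<close>.\<close>
    define t where "t = d powr (\<gamma> / \<alpha>) * normD f z"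
    have t0: "0 \<le> t" by (simp add: t_def normD_nonneg)
    have tH: "t powr \<alpha> = H z"
      using alpha d by (simp add: t_def H_def d_def powr_mult powr_powr normD_nonneg)
    have t2: "t\<^sup>2 \<le> 1 + H z"
      using square_le_powr[OF t0 zero_less_one alpha(1)] tH by simp
    have t1: "t \<le> 2 + H z"
    proof -
      have "0 \<le> H z" by (simp add: H_def)
      moreover have "2 * t \<le> t\<^sup>2 + 1" using zero_le_power2[of "t - 1"] by (simp add: power2_diff)
      ultimately show ?thesis using t2 by linarith
    qed
    \<comment> \<open>As d \<le> 1 and q \<ge> \<gamma>/\<alpha>, the weight d^q is at most
      d^(\<gamma>/\<alpha>).\<close>
    have dt: "d powr q * normD f z \<le> t"
      unfolding t_def using d q_ge by (intro mult_right_mono powr_mono' normD_nonneg) auto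
    have dD: "(d powr q * normD f z)\<^sup>2 \<le> 1 + H z"
      using power_mono[OF dt, of 2] t2 by (simp add: normD_nonneg)
    have "d powr q * norm (laplacian f z) \<le> d powr q * (A1 * normD f z + A2 * (B * d powr (- q)) + M * d powr (- q))"
    proof (intro mult_left_mono)
      have "norm (laplacian f z) \<le> a z * normD f z + b z * cmod (f z) + c z" using ineq z by blast
      also have "\<dots> \<le> A1 * normD f z + A2 * (B * d powr (- q)) + M * d powr (- q)"
        using A1 A2 B(2)[OF z] c_bd z abc_nonneg unfolding d_def
        by (intro add_mono mult_mono) (auto simp: normD_nonneg)
      finally show "norm (laplacian f z) \<le> A1 * normD f z + A2 * (B * d powr (- q)) + M * d powr (- q)" .
    qed simp
    also have "\<dots> = A1 * (d powr q * normD f z) + A2 * B * (d powr q * d powr (- q)) + M * (d powr q * d powr (- q))"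
      by (simp only: distrib_left mult_ac)
    also have "\<dots> \<le> A1 * (2 + H z) + A2 * B + M"
      unfolding dq using dt t1 A1 by (simp add: mult_left_mono)
    finally have lap: "d powr q * norm (laplacian f z) \<le> A1 * (2 + H z) + A2 * B + M" .
    define Bz where "Bz = B * d powr (- q)"
    have Bz: "0 < Bz" "norm (f z) \<le> Bz" using B d z by (auto simp: Bz_def d_def)
    \<comment> \<open>Each factor of \<bar>f\<bar> consumes d^q from the weight d^(pq): with p - 1
      factors d^q is left for the Laplacian term, with p - 2 factors d^(2q) is left for the gradient
      term.\<close>
    have e: "d powr (p * q) * Bz powr r = B powr r * d powr (p * q - q * r)" for r
      using B(1) d powr_add[of d "p * q" "- (q * r)"] by (simp add: Bz_def powr_mult powr_powr)
    have "p * q - q * (p - 1) = q" "p * q - q * (p - 2) = q + q"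
      by (simp_all add: algebra_simps)
    then have e1: "d powr (p * q) * Bz powr (p - 1) = B powr (p - 1) * d powr q"
      and e2: "d powr (p * q) * Bz powr (p - 2) = B powr (p - 2) * (d powr q)\<^sup>2"
      using e[of "p - 1"] e[of "p - 2"] powr_add[of d q q] by (simp_all add: power2_eq_square)
    have "norm (d powr (p * q) * ?L z) = d powr (p * q) * \<bar>?L z\<bar>"
      by (simp add: abs_mult)
    also have "\<dots> \<le> d powr (p * q) * (p * (Bz powr (p - 1) * norm (laplacian f z) + 2 * (p - 1) * Bz powr (p - 2) * (normD f z)\<^sup>2))"
      by (intro mult_left_mono abs_Re_laplacian_norm_powr_le[OF p open_unit_ball f2 z Bz]) simp
    also have "\<dots> = p * ((d powr (p * q) * Bz powr (p - 1)) * norm (laplacian f z)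
        + 2 * (p - 1) * (d powr (p * q) * Bz powr (p - 2)) * (normD f z)\<^sup>2)"
      by (simp only: distrib_left mult_ac)
    also have "\<dots> = K1 * (d powr q * norm (laplacian f z)) + K2 * (d powr q * normD f z)\<^sup>2"
      unfolding e1 e2 K1_def K2_def by (simp only: distrib_left mult_ac power_mult_distrib)
    also have "\<dots> \<le> K1 * (A1 * (2 + H z) + A2 * B + M) + K2 * (1 + H z)"
      by (intro add_mono mult_left_mono lap dD K)
    finally show ?thesis by (simp add: d_def)
  qed
  \<comment> \<open>Finite volume makes the constants in the dominating function integrable.\<close>
  interpret finite_measure "lebesgue_on ?S"
    by (rule finite_measure_lebesgue_on) (simp add: unit_ball_def)
  have meas: "g \<in> borel_measurable (lebesgue_on ?S)" if "continuous_on ?S g" for g :: "complex^'n \<Rightarrow> 'b::{second_countable_topology, metric_space}"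
    using that S by (rule continuous_imp_measurable_on_sets_lebesgue)
  have f2': "Ck (Suc (Suc 0)) f ?S" using f2 by (simp only: numeral_2_eq_2)
  have [measurable]: "f \<in> borel_measurable (lebesgue_on ?S)" "dist_bd \<in> borel_measurable (lebesgue_on ?S)"
    "dirD f v \<in> borel_measurable (lebesgue_on ?S)"
    "basis_laplacian f \<in> borel_measurable (lebesgue_on ?S)" for v
    by (intro meas continuous_on_dist_bd Ck_continuous[OF f2] Ck_continuous[OF Ck_dirD[OF f2']]
        Ck_continuous[OF Ck_basis_laplacian[OF open_unit_ball f2']])+
  have [measurable]: "(\<lambda>z. norm_pow_map_deriv p (f z) (dirD f v z)) \<in> borel_measurable (lebesgue_on ?S)" for v
    by (rule borel_measurable_norm_pow_map_deriv) measurable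
  have "integrable (lebesgue_on ?S) (\<lambda>z. dist_bd z powr (p * q) * ?L z)"
  proof (rule Bochner_Integration.integrable_bound)
    show "integrable (lebesgue_on ?S) (\<lambda>z. K1 * (A1 * (2 + H z) + A2 * B + M) + K2 * (1 + H z))"
      by (intro Bochner_Integration.integrable_add integrable_mult_right integrable_const H)
    \<comment> \<open>Measurability is read off the explicit formula for the Laplacian of
      \<bar>f\<bar>^p, whose ingredients are continuous derivatives of \<open>f\<close> composed
      with Borel maps.\<close>
    have "(\<lambda>z. dist_bd z powr (p * q) * (p * (norm_pow_map p (f z) \<bullet> basis_laplacian f z +
      (\<Sum>v\<in>Basis. norm_pow_map_deriv p (f z) (dirD f v z) \<bullet> dirD f v z)))) \<in> borel_measurable (lebesgue_on ?S)"
      by measurable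
    then show "(\<lambda>z. dist_bd z powr (p * q) * ?L z) \<in> borel_measurable (lebesgue_on ?S)"
      by (rule measurable_cong[THEN iffD1, rotated])
        (simp add: Re_laplacian_norm_powr[OF p open_unit_ball f2] laplacian_eq_basis_laplacian[OF open_unit_ball f2])
    show "AE z in lebesgue_on ?S. norm (dist_bd z powr (p * q) * ?L z) \<le> norm (K1 * (A1 * (2 + H z) + A2 * B + M) + K2 * (1 + H z))"
      using bound by (intro AE_I2) (force intro: order_trans[OF _ abs_ge_self])
  qed
  then show ?thesis by (simp only: integrable_dV_N_iff)
qed

end
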